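(* Let $G=(V,E)$ be a finite graph with $n:=|V|$, let $d_v$ denote the degree of $v\in V$, let $\bar d:=\frac1n\sum_{v\in V}d_v$ be the average degree and $\delta:=\min_{v\in V}d_v$, with $\delta\ge1$. Let $K\in\mathbb{N}$, $K\ge1$, $p\in[0,1]^V$ and $\nu\in(0,\infty)^V$. Suppose that $\lambda_v=d_v/\bar d$ and $p_v\le\frac23K/d_v$ for all $v\in V$. Suppose also that $\nu_v<s_v$ for all $v\in V$, where $s=(s_v)_{v\in V}$ are the equilibrium service rates of $\mathsf{MCH}_\Omega(\lambda,p)$. Let $Q\sim\mathsf{QMCH}_\Omega(\lambda,p;\nu,\mathbf 1)$. Then, in equilibrium, $$\mathbb{E}[Q^0_v]\le\frac{18\,\bar d\,n\log(2en)}{\delta\,(s_v-\nu_v)^2}\qquad\text{for all }v\in V.$$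
   Context: Graphs are finite, undirected, without loops or multiple edges, with non-empty vertex set. Write $[K]=\{1,\dots,K\}$, $[K]_0=\{0,1,\dots,K\}$ and $\mathbb{N}=\{0,1,2,\dots\}$ for the set of possible queue lengths. State space: $\Omega:=\{\omega\in[K]_0^V : \omega \text{ is proper}\}$, where $\omega=(\omega_v)_{v\in V}$ is proper if $\omega_u\ne\omega_v$ whenever $\{u,v\}\in E$ and $\omega_u+\omega_v>0$. A vertex $v$ is active in $\omega$ if $\omega_v\neq 0$; colour $0$ means inactive. For $\lambda\in(0,\infty)^V$ and $p\in[0,1]^V$, the chain $\mathsf{MCH}_\Omega(\lambda,p)$ (multicoloured hardcore model) is the continuous-time Markov chain on $\Omega$ in which each vertex $v\in V$ is selected for update at rate $\lambda_v$, independently over the vertices. When $v$ is selected, toss a coin $C\sim\mathrm{Bern}(p_v)$ and independently draw a colour $k\sim\mathrm{Unif}([K])$. If $C=1$ and no neighbour of $v$ currently has colour $k$, then set $v$ to colour $k$; otherwise (if $C=0$ or some neighbour has colour $k$), set $v$ to colour $0$. Its equilibrium (invariant) distribution is denoted $\pi$, and the equilibrium service rates are $s_v:=\sum_{\omega\in\Omega:\,\omega_v\ne0}\pi(\omega)$ for $v\in V$. Queueing network $\mathsf{QMCH}_\Omega(\lambda,p;\nu,\mu)$, for $\nu,\mu\in(0,\infty)^V$: let $X\sim\mathsf{MCH}_\Omega(\lambda,p)$. The queue-length process $Q=(Q^t)_{t\ge0}$ takes values in $\mathbb{N}^V$; given that the current value of $X$ is $x$, for each $v\in V$ the queue vector $q$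 jumps to $q+e_v$ at rate $\nu_v$ (arrival) and, if $q_v\ge1$, to $q-e_v$ at rate $\mu_v\mathbf 1\{x_v\ne0\}$ (service), where $e_v$ is the unit vector at $v$. Arrivals and potential services are independent of the evolution of $X$, and the pair $(X,Q)$ is a Markov chain on $\Omega\times\mathbb{N}^V$. $\mathbf 1$ denotes the all-ones vector, so $\mu_v=1$ for all $v$. "In equilibrium" means that $(X,Q)$ is stationary. *)

theory Defs
  imports "HOL-Probability.Probability"
begin

section \<open>Graphs on a finite vertex type\<close>

definition simple_graph :: "'v set set \<Rightarrow> bool" where
  "simple_graph E \<longleftrightarrow> (\<forall>e\<in>E. card e = 2)"

definition vertex_degree :: "'v set set \<Rightarrow> 'v \<Rightarrow> nat" where
  "vertex_degree E v = card {u. {u, v} \<in> E}"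

definition min_degree :: "'v::finite set set \<Rightarrow> nat" where
  "min_degree E = Min (range (vertex_degree E))"

definition avg_degree :: "'v::finite set set \<Rightarrow> real" where
  "avg_degree E = (\<Sum>v\<in>UNIV. real (vertex_degree E v)) / real CARD('v)"


section \<open>Continuous-time Markov chains with given jump rates\<close>

text \<open>
  The number \<open>r x y\<close> is the rate of the jump from \<open>x\<close> to \<open>y \<noteq> x\<close>; diagonal values of \<open>r\<close>
  are ignored. The last two clauses are the infinitesimal description
  \<open>P h x y = r x y * h + o(h)\<close> and \<open>P h x x = 1 - (\<Sum>y\<noteq>x. r x y) * h + o(h)\<close>.
  If the total jump rates are bounded, they determine \<open>P t x\<close> for \<open>t \<ge> 0\<close> and \<open>x \<in> S\<close>.
\<close>

definition transition_semigroup ::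
    "'s set \<Rightarrow> ('s \<Rightarrow> 's \<Rightarrow> real) \<Rightarrow> (real \<Rightarrow> 's \<Rightarrow> 's pmf) \<Rightarrow> bool" where
  "transition_semigroup S r P \<longleftrightarrow>
     (\<forall>t\<ge>0. \<forall>x\<in>S. set_pmf (P t x) \<subseteq> S) \<and>
     (\<forall>x\<in>S. P 0 x = return_pmf x) \<and>
     (\<forall>s\<ge>0. \<forall>t\<ge>0. \<forall>x\<in>S. P (s + t) x = bind_pmf (P s x) (P t)) \<and>
     (\<forall>x\<in>S. \<forall>y\<in>S. x \<noteq> y \<longrightarrow> ((\<lambda>h. pmf (P h x) y / h) \<longlongrightarrow> r x y) (at_right 0)) \<and>
     (\<forall>x\<in>S. ((\<lambda>h. (1 - pmf (P h x) x) / h) \<longlongrightarrow> (\<Sum>\<^sub>\<infinity>y\<in>S - {x}. r x y)) (at_right 0))"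

definition invariant_distribution ::
    "'s set \<Rightarrow> ('s \<Rightarrow> 's \<Rightarrow> real) \<Rightarrow> 's pmf \<Rightarrow> bool" where
  "invariant_distribution S r \<pi> \<longleftrightarrow>
     set_pmf \<pi> \<subseteq> S \<and>
     (\<exists>P. transition_semigroup S r P \<and> (\<forall>t\<ge>0. bind_pmf \<pi> (P t) = \<pi>))"

definition markov_chain ::
    "'a measure \<Rightarrow> (real \<Rightarrow> 'a \<Rightarrow> 's) \<Rightarrow> 's set \<Rightarrow> ('s \<Rightarrow> 's \<Rightarrow> real) \<Rightarrow> bool" where
  "markov_chain M Z S r \<longleftrightarrow>
     prob_space M \<and>
     (\<forall>t\<ge>0. Z t \<in> measurable M (count_space S)) \<and>
     (\<exists>P. transition_semigroup S r P \<and>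
        (\<forall>n (t :: nat \<Rightarrow> real) x.
           0 \<le> t 0 \<longrightarrow> (\<forall>i<n. t i \<le> t (Suc i)) \<longrightarrow> (\<forall>i\<le>n. x i \<in> S) \<longrightarrow>
           measure M {\<omega> \<in> space M. \<forall>i\<le>n. Z (t i) \<omega> = x i} =
             measure M {\<omega> \<in> space M. Z (t 0) \<omega> = x 0} *
             (\<Prod>i<n. pmf (P (t (Suc i) - t i) (x i)) (x (Suc i)))))"

text \<open>
  Shift-invariance of all finite-dimensional distributions. Point probabilities suffice
  because this is only used for processes with countably many states.
\<close>

definition stationary_process :: "'a measure \<Rightarrow> (real \<Rightarrow> 'a \<Rightarrow> 's) \<Rightarrow> bool" where
  "stationary_process M Z \<longleftrightarrow>
     (\<forall>h\<ge>0. \<forall>n (t :: nat \<Rightarrow> real) x. (\<forall>i\<le>n. 0 \<le> t i) \<longrightarrow>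
        measure M {\<omega> \<in> space M. \<forall>i\<le>n. Z (t i + h) \<omega> = x i} =
        measure M {\<omega> \<in> space M. \<forall>i\<le>n. Z (t i) \<omega> = x i})"


section \<open>The multicoloured hardcore model\<close>

definition proper :: "'v set set \<Rightarrow> ('v \<Rightarrow> nat) \<Rightarrow> bool" where
  "proper E \<omega> \<longleftrightarrow> (\<forall>u v. {u, v} \<in> E \<and> \<omega> u + \<omega> v > 0 \<longrightarrow> \<omega> u \<noteq> \<omega> v)"

definition mch_states :: "'v set set \<Rightarrow> nat \<Rightarrow> ('v \<Rightarrow> nat) set" where
  "mch_states E K = {\<omega>. (\<forall>v. \<omega> v \<in> {0..K}) \<and> proper E \<omega>}"

definition mch_update ::
    "'v set set \<Rightarrow> nat \<Rightarrow> ('v \<Rightarrow> real) \<Rightarrow> 'v \<Rightarrow> ('v \<Rightarrow> nat) \<Rightarrow> ('v \<Rightarrow> nat) pmf" where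
  "mch_update E K p v x =
     bind_pmf (bernoulli_pmf (p v)) (\<lambda>C.
     bind_pmf (pmf_of_set {1..K}) (\<lambda>k.
     return_pmf (if C \<and> (\<forall>u. {u, v} \<in> E \<longrightarrow> x u \<noteq> k) then x(v := k) else x(v := 0))))"

definition mch_rate ::
    "'v::finite set set \<Rightarrow> nat \<Rightarrow> ('v \<Rightarrow> real) \<Rightarrow> ('v \<Rightarrow> real) \<Rightarrow>
     ('v \<Rightarrow> nat) \<Rightarrow> ('v \<Rightarrow> nat) \<Rightarrow> real" where
  "mch_rate E K lam p x y = (\<Sum>v\<in>UNIV. lam v * pmf (mch_update E K p v x) y)"

definition mch_equilibrium ::
    "'v::finite set set \<Rightarrow> nat \<Rightarrow> ('v \<Rightarrow> real) \<Rightarrow> ('v \<Rightarrow> real) \<Rightarrow> ('v \<Rightarrow> nat) pmf \<Rightarrow> bool" where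
  "mch_equilibrium E K lam p \<pi> \<longleftrightarrow>
     invariant_distribution (mch_states E K) (mch_rate E K lam p) \<pi>"

definition service_rate :: "'v set set \<Rightarrow> nat \<Rightarrow> ('v \<Rightarrow> nat) pmf \<Rightarrow> 'v \<Rightarrow> real" where
  "service_rate E K \<pi> v = (\<Sum>\<omega> \<in> {\<omega> \<in> mch_states E K. \<omega> v \<noteq> 0}. pmf \<pi> \<omega>)"

lemma finite_mch_states: "finite (mch_states (E :: 'v::finite set set) K)"
proof (rule finite_subset)
  show "mch_states E K \<subseteq> PiE UNIV (\<lambda>_. {0..K})"
    by (auto simp: mch_states_def)
  show "finite (PiE (UNIV :: 'v set) (\<lambda>_. {0..K}))"
    by (intro finite_PiE) auto
qed


section \<open>The queueing network driven by the multicoloured hardcore model\<close>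

definition qmch_states :: "'v set set \<Rightarrow> nat \<Rightarrow> (('v \<Rightarrow> nat) \<times> ('v \<Rightarrow> nat)) set" where
  "qmch_states E K = mch_states E K \<times> UNIV"

text \<open>The three summands are the moves of the hardcore chain, the arrivals and the services.\<close>

definition qmch_rate ::
    "'v::finite set set \<Rightarrow> nat \<Rightarrow> ('v \<Rightarrow> real) \<Rightarrow> ('v \<Rightarrow> real) \<Rightarrow> ('v \<Rightarrow> real) \<Rightarrow> ('v \<Rightarrow> real) \<Rightarrow>
     ('v \<Rightarrow> nat) \<times> ('v \<Rightarrow> nat) \<Rightarrow> ('v \<Rightarrow> nat) \<times> ('v \<Rightarrow> nat) \<Rightarrow> real" where
  "qmch_rate E K lam p nu mu = (\<lambda>(x, q) (x', q').
     (if q' = q then mch_rate E K lam p x x' else 0) +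
     (\<Sum>v\<in>UNIV. if x' = x \<and> q' = q(v := q v + 1) then nu v else 0) +
     (\<Sum>v\<in>UNIV. if x' = x \<and> 1 \<le> q v \<and> q' = q(v := q v - 1)
                 then mu v * (if x v \<noteq> 0 then 1 else 0) else 0))"

definition qmch ::
    "'a measure \<Rightarrow> 'v::finite set set \<Rightarrow> nat \<Rightarrow> ('v \<Rightarrow> real) \<Rightarrow> ('v \<Rightarrow> real) \<Rightarrow>
     ('v \<Rightarrow> real) \<Rightarrow> ('v \<Rightarrow> real) \<Rightarrow>
     (real \<Rightarrow> 'a \<Rightarrow> ('v \<Rightarrow> nat)) \<Rightarrow> (real \<Rightarrow> 'a \<Rightarrow> ('v \<Rightarrow> nat)) \<Rightarrow> bool" where
  "qmch M E K lam p nu mu X Q \<longleftrightarrow>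
     markov_chain M (\<lambda>t \<omega>. (X t \<omega>, Q t \<omega>)) (qmch_states E K) (qmch_rate E K lam p nu mu)"

end

theory Submission
  imports Defs
begin

text \<open>
  Run two copies of the hardcore chain with the same updated vertices, coins and colours, and measure
  their distance by counting, over all vertices of disagreement, the nonzero colours involved.
  Under the assumptions on \<open>lam\<close> and \<open>p\<close> the expected distance contracts at rate
  \<open>\<delta> / (3 d)\<close>, with \<open>\<delta>\<close> the minimum and \<open>d\<close> the average degree, so the Poisson equation
  \<open>L g = 1{x\<^sub>v \<noteq> 0} - s\<^sub>v\<close> for the generator \<open>L\<close> of the chain has (approximate) solutions
  \<open>g \<ge> 0\<close> bounded by \<open>6 d n / \<delta>\<close>. The drift of the Lyapunov function
  \<open>q\<^sub>v\<^sup>2 / 2 + q\<^sub>v g(x)\<close> of the network is then at most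
  \<open>1 + 6 d n / \<delta> - (s\<^sub>v - \<nu>\<^sub>v) q\<^sub>v\<close>, up to the error in \<open>g\<close>. Since the mean drift vanishes
  in equilibrium, this bounds the mean queue length by a multiple of
  \<open>d n / (\<delta> (s\<^sub>v - \<nu>\<^sub>v))\<close>, which is stronger than the claim.
\<close>

section \<open>Stationary distributions and the generator\<close>

lemma transition_semigroupD:
  assumes "transition_semigroup S r P" and "x \<in> S"
  shows "P 0 x = return_pmf x"
    and "0 \<le> s \<Longrightarrow> 0 \<le> t \<Longrightarrow> P (s + t) x = bind_pmf (P s x) (P t)"
    and "y \<in> S \<Longrightarrow> x \<noteq> y \<Longrightarrow> ((\<lambda>h. pmf (P h x) y / h) \<longlongrightarrow> r x y) (at_right 0)"
    and "((\<lambda>h. (1 - pmf (P h x) x) / h) \<longlongrightarrow> (\<Sum>\<^sub>\<infinity>y\<in>S - {x}. r x y)) (at_right 0)"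
  using assms unfolding transition_semigroup_def by blast+

text \<open>The probability of being at \<open>x\<close> is supermultiplicative in time, so
  \<open>P t x\<close> keeps at least the \<open>m\<close>-th power of the mass that time
  \<open>t / m\<close> leaves at \<open>x\<close>. Bernoulli's inequality and the exit rate at 0
  then give the bound for every \<open>t\<close>, not only asymptotically. This uniformity supplies
  the dominating constant in \<open>stationary_generator\<close>.\<close>

lemma transition_semigroup_exit_bound:
  assumes P: "transition_semigroup S r P" and x: "x \<in> S" and t: "0 \<le> t"
  shows "1 - pmf (P t x) x \<le> (\<Sum>\<^sub>\<infinity>y\<in>S - {x}. r x y) * t"
proof (cases "t = 0")
  case True
  then show ?thesis by (simp add: transition_semigroupD(1)[OF P x])
next
  case False
  with t have t: "0 < t" by simp
  define q where "q = (\<Sum>\<^sub>\<infinity>y\<in>S - {x}. r x y)"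
  \<comment> \<open>Among all ways to be at \<open>x\<close> at time \<open>s + u\<close>, keep only
    those that are also at \<open>x\<close> at time \<open>s\<close>.\<close>
  have super: "pmf (P s x) x * pmf (P u x) x \<le> pmf (P (s + u) x) x" if "0 \<le> s" "0 \<le> u" for s u
  proof -
    have "pmf (P s x) x * pmf (P u x) x =
        (\<integral>z. indicator {x} z * pmf (P u x) x \<partial>measure_pmf (P s x))"
      by (simp add: pmf.rep_eq)
    also have "\<dots> \<le> (\<integral>z. pmf (P u z) x \<partial>measure_pmf (P s x))"
      by (intro integral_mono measure_pmf.integrable_const_bound[where B = 1])
        (auto simp: indicator_def pmf_le_1)
    also have "\<dots> = pmf (P (s + u) x) x"
      by (simp add: transition_semigroupD(2)[OF P x that] pmf_bind)
    finally show ?thesis .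
  qed
  have power: "pmf (P u x) x ^ m \<le> pmf (P (real m * u) x) x" if "0 \<le> u" for u m
  proof (induction m)
    case 0
    then show ?case by (simp add: transition_semigroupD(1)[OF P x])
  next
    case (Suc m)
    have "pmf (P u x) x ^ Suc m \<le> pmf (P u x) x * pmf (P (real m * u) x) x"
      using Suc by (simp add: mult_left_mono)
    also have "\<dots> \<le> pmf (P (real (Suc m) * u) x) x"
      using super[of u "real m * u"] that by (simp add: algebra_simps)
    finally show ?case .
  qed
  have lim: "((\<lambda>h. (1 - pmf (P h x) x) / h) \<longlongrightarrow> q) (at_right 0)"
    unfolding q_def by (rule transition_semigroupD(4)[OF P x])
  have "1 - pmf (P t x) x \<le> q * t + e" if e: "0 < e" for e
  proof -
    have "eventually (\<lambda>h. (1 - pmf (P h x) x) / h < q + e / t) (at_right 0)"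
      using lim by (rule order_tendstoD) (use e t in simp)
    then obtain b where b: "0 < b"
      "\<And>h. 0 < h \<Longrightarrow> h < b \<Longrightarrow> (1 - pmf (P h x) x) / h < q + e / t"
      unfolding eventually_at_right_field by auto
    \<comment> \<open>Cut \<open>[0, t]\<close> into \<open>m\<close> pieces so short that the
      asymptotic exit rate, with slack \<open>e / t\<close>, already holds on each of them.\<close>
    obtain m where m: "t / b < real m" using reals_Archimedean2 by blast
    with t b(1) have "0 < real m" by (meson divide_pos_pos order_less_trans)
    define h where "h = t / real m"
    have h: "0 < h" "h < b" "real m * h = t"
      using t b(1) m \<open>0 < real m\<close> by (auto simp: h_def field_simps)
    have "1 - pmf (P h x) x \<le> (q + e / t) * h"
      using b(2)[OF h(1,2)] h(1) by (simp add: pos_divide_less_eq)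
    then have "real m * (1 - pmf (P h x) x) \<le> real m * ((q + e / t) * h)"
      by (rule mult_left_mono) simp
    also have "\<dots> = q * t + e"
      unfolding mult.left_commute[of "real m"] h(3) using t by (simp add: distrib_right)
    finally have "real m * (1 - pmf (P h x) x) \<le> q * t + e" .
    moreover have "1 + real m * (pmf (P h x) x - 1) \<le> pmf (P h x) x ^ m"
      using Bernoulli_inequality[of "pmf (P h x) x - 1" m] by simp
    moreover have "pmf (P h x) x ^ m \<le> pmf (P t x) x"
      using power[of h m] h by simp
    ultimately show ?thesis by (simp add: algebra_simps)
  qed
  then show ?thesis unfolding q_def by (rule field_le_epsilon)
qed

text \<open>The sum accounts exactly for the increments into \<open>F\<close>; every other increment
  is at most \<open>2 * B\<close>, and the remaining factor is the mass outside
  \<open>F\<close>.\<close>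

lemma expectation_increment_bound:
  fixes \<phi> :: "'s \<Rightarrow> real"
  assumes B: "\<And>y. \<bar>\<phi> y\<bar> \<le> B" and F: "finite F" "x \<in> F"
  shows "\<bar>measure_pmf.expectation N \<phi> - \<phi> x - (\<Sum>y\<in>F. pmf N y * (\<phi> y - \<phi> x))\<bar>
    \<le> 2 * B * (1 - (\<Sum>y\<in>F. pmf N y))"
proof -
  let ?E = "measure_pmf.expectation N"
  have int: "integrable (measure_pmf N) g" if "\<And>y. \<bar>g y\<bar> \<le> C" for g :: "'s \<Rightarrow> real" and C
    using that by (intro measure_pmf.integrable_const_bound[where B = C]) auto
  have i1: "integrable (measure_pmf N) \<phi>" using B by (rule int)
  have i2: "integrable (measure_pmf N) (\<lambda>y. indicator F y * (\<phi> y - \<phi> x))"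
  proof (rule int[of _ "2 * B"])
    show "\<bar>indicator F y * (\<phi> y - \<phi> x)\<bar> \<le> 2 * B" for y
      using B[of x] B[of y] by (auto simp: indicator_def abs_le_iff)
  qed
  have fin: "?E (\<lambda>y. indicator F y * g y) = (\<Sum>y\<in>F. pmf N y * g y)" for g
    by (subst integral_measure_pmf[OF F(1)]) (auto simp: indicator_def intro!: sum.cong)
  have "?E \<phi> - \<phi> x - (\<Sum>y\<in>F. pmf N y * (\<phi> y - \<phi> x)) =
      ?E (\<lambda>y. (\<phi> y - \<phi> x) - indicator F y * (\<phi> y - \<phi> x))"
    using i1 i2 by (simp add: fin)
  also have "\<bar>\<dots>\<bar> \<le> ?E (\<lambda>y. \<bar>(\<phi> y - \<phi> x) - indicator F y * (\<phi> y - \<phi> x)\<bar>)"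
    by (rule integral_abs_bound)
  also have "\<dots> \<le> ?E (\<lambda>y. 2 * B * (1 - indicator F y * 1))"
  proof (rule integral_mono)
    show "integrable (measure_pmf N) (\<lambda>y. \<bar>(\<phi> y - \<phi> x) - indicator F y * (\<phi> y - \<phi> x)\<bar>)"
      using i1 i2 by simp
    show "integrable (measure_pmf N) (\<lambda>y. 2 * B * (1 - indicator F y * 1))"
      by (rule int[of _ "\<bar>2 * B\<bar>"]) (auto simp: indicator_def)
    show "\<bar>(\<phi> y - \<phi> x) - indicator F y * (\<phi> y - \<phi> x)\<bar> \<le> 2 * B * (1 - indicator F y * 1)" for y
      using B[of x] B[of y] by (auto simp: indicator_def abs_le_iff)
  qed
  also have "\<dots> = 2 * B * (1 - ?E (\<lambda>y. indicator F y * 1))"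
  proof -
    have "integrable (measure_pmf N) (\<lambda>y. indicator F y * 1 :: real)"
      by (rule int[of _ 1]) (auto simp: indicator_def)
    then show ?thesis by (simp del: mult_1_right)
  qed
  also have "\<dots> = 2 * B * (1 - (\<Sum>y\<in>F. pmf N y))"
    by (subst fin) simp
  finally show ?thesis .
qed

lemma expectation_bind_pmf:
  fixes \<phi> :: "'b \<Rightarrow> real"
  assumes "\<And>y. \<bar>\<phi> y\<bar> \<le> B"
  shows "measure_pmf.expectation (bind_pmf M N) \<phi> =
    measure_pmf.expectation M (\<lambda>x. measure_pmf.expectation (N x) \<phi>)"
  unfolding measure_pmf_bind
  by (rule integral_bind[where K = "count_space UNIV" and B = B and B' = 1])
    (use assms in \<open>auto simp: measure_pmf.finite_measure_axioms measure_pmf.emeasure_space_1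
      measure_pmf_in_subprob_algebra\<close>)

text \<open>The rates only describe single transitions, so mass escaping from \<open>F\<close> has
  to be controlled. It is \<open>o(h)\<close>, because the exit rate from \<open>x\<close> is
  already exhausted by the jumps into \<open>F\<close>; for bounded \<open>\<phi>\<close> it does
  not contribute to the derivative.\<close>

lemma transition_semigroup_generator:
  fixes \<phi> :: "'s \<Rightarrow> real"
  assumes P: "transition_semigroup S r P" and x: "x \<in> S"
    and F: "finite F" "F \<subseteq> S" "x \<in> F" and r0: "\<And>y. y \<in> S - F \<Longrightarrow> r x y = 0"
    and B: "\<And>y. \<bar>\<phi> y\<bar> \<le> B"
  shows "((\<lambda>h. (measure_pmf.expectation (P h x) \<phi> - \<phi> x) / h)
    \<longlongrightarrow> (\<Sum>y\<in>F. r x y * (\<phi> y - \<phi> x))) (at_right 0)"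
proof -
  define D where "D h = measure_pmf.expectation (P h x) \<phi> - \<phi> x" for h
  define G where "G h = (\<Sum>y\<in>F. pmf (P h x) y * (\<phi> y - \<phi> x))" for h
  have split: "sum g F = g x + sum g (F - {x})" for g :: "'s \<Rightarrow> real"
    using F by (simp add: sum.remove)
  have rate: "((\<lambda>h. pmf (P h x) y / h) \<longlongrightarrow> r x y) (at_right 0)" if "y \<in> F - {x}" for y
    by (rule transition_semigroupD(3)[OF P x]) (use that F(2) in auto)
  have "(\<Sum>\<^sub>\<infinity>y\<in>S - {x}. r x y) = (\<Sum>\<^sub>\<infinity>y\<in>F - {x}. r x y)"
    by (rule infsum_cong_neutral) (use F r0 in auto)
  then have exit: "((\<lambda>h. (1 - pmf (P h x) x) / h) \<longlongrightarrow> (\<Sum>y\<in>F - {x}. r x y)) (at_right 0)"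
    using transition_semigroupD(4)[OF P x] F(1) by simp
  \<comment> \<open>The total exit rate and the sum of the individual rates have the same limit, so
    their difference, the mass outside \<open>F\<close> divided by \<open>h\<close>,
    vanishes.\<close>
  have "((\<lambda>h. (1 - pmf (P h x) x) / h - (\<Sum>y\<in>F - {x}. pmf (P h x) y / h)) \<longlongrightarrow>
      (\<Sum>y\<in>F - {x}. r x y) - (\<Sum>y\<in>F - {x}. r x y)) (at_right 0)"
    by (intro tendsto_diff exit tendsto_sum rate)
  then have rest: "((\<lambda>h. (1 - (\<Sum>y\<in>F. pmf (P h x) y)) / h) \<longlongrightarrow> 0) (at_right 0)"
    by (simp add: split diff_divide_distrib add_divide_distrib sum_divide_distrib diff_diff_eq)
  have "((\<lambda>h. \<Sum>y\<in>F - {x}. pmf (P h x) y / h * (\<phi> y - \<phi> x)) \<longlongrightarrow>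
      (\<Sum>y\<in>F - {x}. r x y * (\<phi> y - \<phi> x))) (at_right 0)"
    by (intro tendsto_sum tendsto_mult rate tendsto_const)
  then have G: "((\<lambda>h. G h / h) \<longlongrightarrow> (\<Sum>y\<in>F. r x y * (\<phi> y - \<phi> x))) (at_right 0)"
    by (simp add: split G_def sum_divide_distrib)
  have "((\<lambda>h. D h / h - G h / h) \<longlongrightarrow> 0) (at_right 0)"
  proof (rule Lim_null_comparison)
    show "((\<lambda>h. 2 * B * ((1 - (\<Sum>y\<in>F. pmf (P h x) y)) / h)) \<longlongrightarrow> 0) (at_right 0)"
      using tendsto_mult[OF tendsto_const rest] by simp
    show "\<forall>\<^sub>F h in at_right 0. norm (D h / h - G h / h)
        \<le> 2 * B * ((1 - (\<Sum>y\<in>F. pmf (P h x) y)) / h)"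
      using eventually_at_right_less[of "0 :: real"]
    proof eventually_elim
      case (elim h)
      have "\<bar>D h - G h\<bar> / h \<le> 2 * B * (1 - (\<Sum>y\<in>F. pmf (P h x) y)) / h"
        unfolding D_def G_def
        by (intro divide_right_mono expectation_increment_bound[OF B F(1,3)]) (use elim in simp)
      then show ?case using elim by (simp add: diff_divide_distrib[symmetric])
    qed
  qed
  from tendsto_add[OF this G] show ?thesis by (simp add: D_def)
qed

text \<open>By invariance the mean difference quotient is exactly 0 for every positive step.
  Dominated convergence carries this to the generator, with the constant \<open>2 * B * R\<close>
  coming from the exit bound.\<close>

lemma stationary_generator:
  fixes \<phi> :: "'s \<Rightarrow> real"
  assumes P: "transition_semigroup S r P" and \<mu>: "set_pmf \<mu> \<subseteq> S"
    and inv: "\<And>t. 0 \<le> t \<Longrightarrow> bind_pmf \<mu> (P t) = \<mu>"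
    and F: "\<And>x. x \<in> S \<Longrightarrow> finite (F x)" "\<And>x. x \<in> S \<Longrightarrow> F x \<subseteq> S" "\<And>x. x \<in> S \<Longrightarrow> x \<in> F x"
    and r0: "\<And>x y. x \<in> S \<Longrightarrow> y \<in> S - F x \<Longrightarrow> r x y = 0"
    and R: "\<And>x. x \<in> S \<Longrightarrow> (\<Sum>y\<in>F x - {x}. r x y) \<le> R"
    and B: "\<And>y. \<bar>\<phi> y\<bar> \<le> B"
  shows "integrable (measure_pmf \<mu>) (\<lambda>x. \<Sum>y\<in>F x. r x y * (\<phi> y - \<phi> x))"
    and "measure_pmf.expectation \<mu> (\<lambda>x. \<Sum>y\<in>F x. r x y * (\<phi> y - \<phi> x)) = 0"
proof -
  \<comment> \<open>Dominated convergence is applied along a sequence, so the limit at 0 from the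
    right is taken along \<open>1 / (i + 1)\<close>.\<close>
  define h where "h i = inverse (real (Suc i))" for i
  define D where "D i x = (measure_pmf.expectation (P (h i) x) \<phi> - \<phi> x) / h i" for i x
  have h: "0 < h i" for i by (simp add: h_def)
  have lim_h: "filterlim h (at_right 0) sequentially"
    unfolding h_def using LIMSEQ_inverse_real_of_nat
    by (intro filterlim_at_withinI) (auto simp: eventually_sequentially)
  have lim: "AE x in measure_pmf \<mu>. (\<lambda>i. D i x) \<longlonglongrightarrow> (\<Sum>y\<in>F x. r x y * (\<phi> y - \<phi> x))"
    using \<mu> unfolding AE_measure_pmf_iff D_def
    by (auto intro!: filterlim_compose[OF transition_semigroup_generator[OF P] lim_h] F r0 B)
  have bound: "AE x in measure_pmf \<mu>. norm (D i x) \<le> 2 * B * R" for i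
  proof (unfold AE_measure_pmf_iff, rule ballI)
    fix x assume "x \<in> set_pmf \<mu>"
    with \<mu> have x: "x \<in> S" by auto
    have "0 \<le> B" using B[of x] by simp
    have "1 - pmf (P (h i) x) x \<le> (\<Sum>\<^sub>\<infinity>y\<in>S - {x}. r x y) * h i"
      using h[of i] by (intro transition_semigroup_exit_bound[OF P x]) simp
    also have "(\<Sum>\<^sub>\<infinity>y\<in>S - {x}. r x y) = (\<Sum>\<^sub>\<infinity>y\<in>F x - {x}. r x y)"
      by (rule infsum_cong_neutral) (use F(2)[OF x] r0[OF x] in auto)
    also have "\<dots> * h i \<le> R * h i"
      using R[OF x] F(1)[OF x] h[of i] by (simp add: mult_right_mono)
    finally have *: "1 - pmf (P (h i) x) x \<le> R * h i" .
    \<comment> \<open>With \<open>F\<close> equal to \<open>{x}\<close> the sum in the increment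
      bound is 0, which leaves the exit probability alone.\<close>
    have "\<bar>measure_pmf.expectation (P (h i) x) \<phi> - \<phi> x\<bar> \<le> 2 * B * (1 - pmf (P (h i) x) x)"
      using expectation_increment_bound[OF B, of "{x}" x] by simp
    also have "\<dots> \<le> 2 * B * (R * h i)"
      by (rule mult_left_mono[OF *]) (use \<open>0 \<le> B\<close> in simp)
    finally show "norm (D i x) \<le> 2 * B * R"
      using h[of i] by (simp add: D_def abs_divide pos_divide_le_eq mult.assoc)
  qed
  show "integrable (measure_pmf \<mu>) (\<lambda>x. \<Sum>y\<in>F x. r x y * (\<phi> y - \<phi> x))"
    by (rule integrable_dominated_convergence[where w = "\<lambda>_. 2 * B * R" and s = D])
      (use lim bound in auto)
  have "(\<lambda>i. measure_pmf.expectation \<mu> (D i)) \<longlonglongrightarrow>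
      measure_pmf.expectation \<mu> (\<lambda>x. \<Sum>y\<in>F x. r x y * (\<phi> y - \<phi> x))"
    by (rule integral_dominated_convergence[where w = "\<lambda>_. 2 * B * R"]) (use lim bound in auto)
  moreover have "measure_pmf.expectation \<mu> (D i) = 0" for i
  proof -
    have e: "\<bar>measure_pmf.expectation (P (h i) x) \<phi>\<bar> \<le> B" for x
    proof -
      have "integrable (measure_pmf (P (h i) x)) \<phi>"
        using B by (intro measure_pmf.integrable_const_bound[where B = B]) auto
      moreover have "- B \<le> \<phi> y" "\<phi> y \<le> B" for y
        using B[of y] by auto
      ultimately show ?thesis
        by (auto simp: abs_le_iff minus_le_iff
            intro!: measure_pmf.integral_le_const measure_pmf.integral_ge_const)
    qed
    have "measure_pmf.expectation \<mu> \<phi> = measure_pmf.expectation (bind_pmf \<mu> (P (h i))) \<phi>"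
      using h[of i] by (simp add: inv)
    also have "\<dots> = measure_pmf.expectation \<mu> (\<lambda>x. measure_pmf.expectation (P (h i) x) \<phi>)"
      using B by (rule expectation_bind_pmf)
    finally show ?thesis
      unfolding D_def using e B
      by (simp add: measure_pmf.integrable_const_bound[where B = B])
  qed
  ultimately show "measure_pmf.expectation \<mu> (\<lambda>x. \<Sum>y\<in>F x. r x y * (\<phi> y - \<phi> x)) = 0"
    by (simp add: LIMSEQ_const_iff)
qed

section \<open>From a stationary process to an invariant distribution\<close>

lemma pmf_of_law:
  fixes f :: "'a \<Rightarrow> 'b::countable"
  assumes M: "prob_space M" and f: "f \<in> measurable M (count_space UNIV)"
  obtains J where "measure_pmf J = distr M (count_space UNIV) f"
    and "\<And>x. pmf J x = measure M {\<omega> \<in> space M. f \<omega> = x}"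
proof -
  interpret D: prob_space "distr M (count_space UNIV) f"
    using M f by (rule prob_space.prob_space_distr)
  have "AE x in distr M (count_space UNIV) f. measure (distr M (count_space UNIV) f) {x} \<noteq> 0"
    by (subst D.AE_support_countable) (auto intro!: exI[of _ UNIV])
  then have J: "measure_pmf (Abs_pmf (distr M (count_space UNIV) f)) = distr M (count_space UNIV) f"
    by (intro Abs_pmf_inverse) (simp add: D.prob_space_axioms)
  have "pmf (Abs_pmf (distr M (count_space UNIV) f)) x = measure M {\<omega> \<in> space M. f \<omega> = x}" for x
    unfolding pmf.rep_eq J using f
    by (subst measure_distr) (auto intro!: arg_cong[where f = "measure M"])
  with J show thesis by (rule that)
qed

text \<open>The finite-dimensional distributions at the two times 0 and \<open>t\<close> identify
  the joint law of \<open>Z 0\<close> and \<open>Z t\<close> as \<open>\<mu>\<close> followed by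
  \<open>P t\<close>. Its second marginal is \<open>\<mu>\<close> again by stationarity.\<close>

lemma stationary_markov_chain_law:
  fixes Z :: "real \<Rightarrow> 'a \<Rightarrow> 's::countable"
  assumes mc: "markov_chain M Z S r" and st: "stationary_process M Z"
  obtains \<mu> P where "Z 0 \<in> measurable M (count_space UNIV)" "measure_pmf \<mu> = distr M (count_space UNIV) (Z 0)"
    "set_pmf \<mu> \<subseteq> S" "transition_semigroup S r P" "\<And>t. 0 \<le> t \<Longrightarrow> bind_pmf \<mu> (P t) = \<mu>"
proof -
  obtain P where M: "prob_space M" and ZS: "\<forall>t\<ge>0. Z t \<in> measurable M (count_space S)"
    and P: "transition_semigroup S r P"
    and fdd: "\<forall>n (t :: nat \<Rightarrow> real) x.
      0 \<le> t 0 \<longrightarrow> (\<forall>i<n. t i \<le> t (Suc i)) \<longrightarrow> (\<forall>i\<le>n. x i \<in> S) \<longrightarrow>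
      measure M {\<omega> \<in> space M. \<forall>i\<le>n. Z (t i) \<omega> = x i} = measure M {\<omega> \<in> space M. Z (t 0) \<omega> = x 0} *
        (\<Prod>i<n. pmf (P (t (Suc i) - t i) (x i)) (x (Suc i)))"
    using mc unfolding markov_chain_def by (elim conjE exE) (rule that)
  have Z: "Z t \<in> measurable M (count_space UNIV)" if "0 \<le> t" for t
    by (rule measurable_compose[OF ZS[rule_format, OF that]]) simp
  have inS: "Z t \<omega> \<in> S" if "0 \<le> t" "\<omega> \<in> space M" for t \<omega>
    using measurable_space[OF ZS[rule_format, OF that(1)] that(2)] by simp
  obtain \<mu> where \<mu>: "measure_pmf \<mu> = distr M (count_space UNIV) (Z 0)"
      "\<And>x. pmf \<mu> x = measure M {\<omega> \<in> space M. Z 0 \<omega> = x}"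
    using pmf_of_law[OF M Z[of 0]] by auto
  have \<mu>0: "pmf \<mu> x = 0" if "x \<notin> S" for x
  proof -
    have "{\<omega> \<in> space M. Z 0 \<omega> = x} = {}" using inS[of 0] that by auto
    then show ?thesis by (simp only: \<mu>(2) measure_empty)
  qed
  have \<mu>S: "set_pmf \<mu> \<subseteq> S"
  proof
    fix x assume "x \<in> set_pmf \<mu>"
    then have "pmf \<mu> x \<noteq> 0" by (simp add: set_pmf_iff)
    with \<mu>0[of x] show "x \<in> S" by argo
  qed
  have "bind_pmf \<mu> (P t) = \<mu>" if t: "0 \<le> t" for t
  proof -
    have "(\<lambda>\<omega>. (Z 0 \<omega>, Z t \<omega>)) \<in> measurable M (count_space UNIV \<Otimes>\<^sub>M count_space UNIV)"
      by (intro measurable_Pair Z order_refl t)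
    then have pair: "(\<lambda>\<omega>. (Z 0 \<omega>, Z t \<omega>)) \<in> measurable M (count_space UNIV)"
      by (simp add: pair_measure_countable)
    obtain J where J: "measure_pmf J = distr M (count_space UNIV) (\<lambda>\<omega>. (Z 0 \<omega>, Z t \<omega>))"
        "\<And>z. pmf J z = measure M {\<omega> \<in> space M. (Z 0 \<omega>, Z t \<omega>) = z}"
      by (rule pmf_of_law[OF M pair]) (rule that)
    have "pmf J (x, y) = pmf (bind_pmf \<mu> (\<lambda>x. map_pmf (Pair x) (P t x))) (x, y)" for x y
    proof -
      have "pmf (bind_pmf \<mu> (\<lambda>x. map_pmf (Pair x) (P t x))) (x, y) =
          measure_pmf.expectation \<mu> (\<lambda>z. indicator {x} z * pmf (P t x) y)"
        unfolding pmf_bind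
      proof (intro Bochner_Integration.integral_cong refl)
        fix z
        show "pmf (map_pmf (Pair z) (P t z)) (x, y) = indicator {x} z * pmf (P t x) y"
        proof (cases "z = x")
          case True
          then show ?thesis by (simp add: pmf_map_inj' inj_on_def)
        next
          case False
          then have "(x, y) \<notin> set_pmf (map_pmf (Pair z) (P t z))" by auto
          then have "pmf (map_pmf (Pair z) (P t z)) (x, y) = 0" by (rule iffD2[OF pmf_eq_0_set_pmf])
          moreover have "indicator {x} z = (0 :: real)" using False by simp
          ultimately show ?thesis by (simp only: mult_zero_left)
        qed
      qed
      also have "\<dots> = pmf \<mu> x * pmf (P t x) y"
        by (simp add: pmf.rep_eq)
      also have "\<dots> = pmf J (x, y)"
      \<comment> \<open>The product formula is only available for states in \<open>S\<close>;
        otherwise both sides vanish, since neither \<open>\<mu>\<close> nor \<open>P t x\<close> for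
        \<open>x\<close> in \<open>S\<close> charges the complement.\<close>
      proof (cases "x \<in> S \<and> y \<in> S")
        case True
        then show ?thesis
          using fdd[rule_format, of "\<lambda>i. if i = 0 then 0 else t" 1 "\<lambda>i. if i = 0 then x else y"] t
          by (simp add: J(2) \<mu>(2) le_Suc_eq all_conj_distrib imp_disjL)
      next
        case False
        then have "{\<omega> \<in> space M. (Z 0 \<omega>, Z t \<omega>) = (x, y)} = {}"
          using inS[of 0] inS[of t] t by auto
        then have "pmf J (x, y) = 0" by (simp only: J(2) measure_empty)
        moreover have "pmf (P t x) y = 0" if "x \<in> S" "y \<notin> S"
          using P t that unfolding transition_semigroup_def
          by (meson in_mono pmf_eq_0_set_pmf)
        ultimately show ?thesis using \<mu>0[of x] False by auto
      qed
      finally show ?thesis ..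
    qed
    then have "J = bind_pmf \<mu> (\<lambda>x. map_pmf (Pair x) (P t x))"
      by (intro pmf_eqI) auto
    then have "map_pmf snd J = bind_pmf \<mu> (P t)"
      by (simp add: map_bind_pmf pmf.map_comp o_def)
    moreover have "pmf (map_pmf snd J) y = pmf \<mu> y" for y
    proof -
      have "pmf (map_pmf snd J) y = measure (measure_pmf J) (snd -` {y})"
        by (simp add: pmf_map)
      also have "\<dots> = measure M {\<omega> \<in> space M. Z t \<omega> = y}"
        unfolding J(1) using pair
        by (subst measure_distr) (auto intro!: arg_cong[where f = "measure M"])
      \<comment> \<open>Stationarity for the single time 0, shifted by \<open>t\<close>.\<close>
      also have "\<dots> = pmf \<mu> y"
        using st t unfolding stationary_process_def \<mu>(2)
        by (auto dest!: spec[of _ t] spec[of _ "0 :: nat"] spec[of _ "\<lambda>_. 0 :: real"] spec[of _ "\<lambda>_. y"])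
      finally show ?thesis .
    qed
    ultimately show ?thesis by (metis pmf_eqI)
  qed
  with Z[OF order_refl] \<mu>(1) \<mu>S P show thesis by (rule that)
qed

text \<open>The function \<open>V\<close> may fail to be integrable. Truncating it to \<open>min V m\<close> makes it bounded and,
  by concavity of the truncation, keeps its drift below that of \<open>V\<close> where \<open>V < m\<close> and
  nonpositive elsewhere.\<close>

lemma stationary_drift:
  fixes V w :: "'s \<Rightarrow> real"
  assumes P: "transition_semigroup S r P" and \<mu>: "set_pmf \<mu> \<subseteq> S"
    and inv: "\<And>t. 0 \<le> t \<Longrightarrow> bind_pmf \<mu> (P t) = \<mu>"
    and F: "\<And>x. x \<in> S \<Longrightarrow> finite (F x)" "\<And>x. x \<in> S \<Longrightarrow> F x \<subseteq> S" "\<And>x. x \<in> S \<Longrightarrow> x \<in> F x"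
    and r0: "\<And>x y. x \<in> S \<Longrightarrow> y \<in> S - F x \<Longrightarrow> r x y = 0"
    and r_nonneg: "\<And>x y. 0 \<le> r x y"
    and R: "\<And>x. x \<in> S \<Longrightarrow> (\<Sum>y\<in>F x. r x y) \<le> R"
    and V: "\<And>x. 0 \<le> V x" and w: "\<And>x. 0 \<le> w x" "\<And>x. w x \<le> V x + 1"
    and drift: "\<And>x. x \<in> S \<Longrightarrow> (\<Sum>y\<in>F x. r x y * (V y - V x)) \<le> c - \<gamma> * w x"
    and c: "0 \<le> c" and \<gamma>: "0 < \<gamma>"
  shows "integrable (measure_pmf \<mu>) w" and "measure_pmf.expectation \<mu> w \<le> c / \<gamma>"
proof -
  define I :: "nat \<Rightarrow> 's \<Rightarrow> real" where "I m x = of_bool (V x < real m)" for m x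
  have int_I: "integrable (measure_pmf \<mu>) (I m)" for m
    by (rule measure_pmf.integrable_const_bound[where B = 1]) (auto simp: I_def)
  have int_w: "integrable (measure_pmf \<mu>) (\<lambda>x. I m x * w x)" for m
  proof (rule measure_pmf.integrable_const_bound[where B = "real m + 1"])
    \<comment> \<open>The bound \<open>w x \<le> V x + 1\<close> turns the cutoff of
      \<open>V\<close> into one of \<open>w\<close>.\<close>
    have "\<bar>I m x * w x\<bar> \<le> real m + 1" for x
      using w[of x] by (auto simp: I_def)
    then show "AE x in measure_pmf \<mu>. norm (I m x * w x) \<le> real m + 1" by simp
  qed simp
  have bound: "measure_pmf.expectation \<mu> (\<lambda>x. I m x * w x) \<le> c / \<gamma>" for m
  proof -
    define \<phi> where "\<phi> x = min (V x) (real m)" for x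
    define A where "A x = (\<Sum>y\<in>F x. r x y * (\<phi> y - \<phi> x))" for x
    have R': "(\<Sum>y\<in>F x - {x}. r x y) \<le> R" if "x \<in> S" for x
      using R[OF that] sum_mono2[OF F(1)[OF that], of "F x - {x}" "r x"] r_nonneg by force
    have \<phi>: "\<bar>\<phi> x\<bar> \<le> real m" for x
      using V[of x] by (auto simp: \<phi>_def)
    note gen = stationary_generator[OF P \<mu> inv F r0 R' \<phi>]
    have int_A: "integrable (measure_pmf \<mu>) A" and A0: "measure_pmf.expectation \<mu> A = 0"
      unfolding A_def by (rule gen; assumption)+
    have "A x \<le> I m x * (c - \<gamma> * w x)" if x: "x \<in> S" for x
    proof (cases "V x < real m")
      case True
      have "A x \<le> (\<Sum>y\<in>F x. r x y * (V y - V x))"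
        unfolding A_def using True by (intro sum_mono mult_left_mono r_nonneg) (auto simp: \<phi>_def)
      with drift[OF x] True show ?thesis by (simp add: I_def)
    next
      case False
      have "A x \<le> (\<Sum>y\<in>F x. 0)"
        unfolding A_def using False
        by (intro sum_mono mult_nonneg_nonpos r_nonneg) (auto simp: \<phi>_def)
      with False show ?thesis by (simp add: I_def)
    qed
    then have "AE x in measure_pmf \<mu>. \<gamma> * (I m x * w x) \<le> c * I m x - A x"
      using \<mu> by (auto simp: AE_measure_pmf_iff algebra_simps subset_eq)
    then have "measure_pmf.expectation \<mu> (\<lambda>x. \<gamma> * (I m x * w x)) \<le>
        measure_pmf.expectation \<mu> (\<lambda>x. c * I m x - A x)"
      using int_w int_I int_A by (intro integral_mono_AE) auto
    then have "\<gamma> * measure_pmf.expectation \<mu> (\<lambda>x. I m x * w x) \<le> c * measure_pmf.expectation \<mu> (I m)"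
      using int_w int_I int_A A0 by simp
    also have "\<dots> \<le> c * 1"
      by (intro mult_left_mono c measure_pmf.integral_le_const int_I) (auto simp: I_def)
    finally show ?thesis using \<gamma> by (simp add: field_simps)
  qed
  have mono: "mono (\<lambda>m. I m x * w x)" for x
    using w(1)[of x] by (intro monoI mult_right_mono) (auto simp: I_def)
  have lim: "(\<lambda>m. I m x * w x) \<longlonglongrightarrow> w x" for x
  proof (rule tendsto_eventually)
    obtain k where k: "V x < real k" using reals_Archimedean2 by blast
    show "\<forall>\<^sub>F m in sequentially. I m x * w x = w x"
      using eventually_ge_at_top[of k]
      by eventually_elim (use k in \<open>auto simp: I_def\<close>)
  qed
  \<comment> \<open>Monotone convergence: the uniform bound on the truncated means gives both
    integrability of \<open>w\<close> and the bound on its mean.\<close>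
  have "incseq (\<lambda>m. measure_pmf.expectation \<mu> (\<lambda>x. I m x * w x))"
    using mono by (intro incseq_SucI integral_mono int_w) (auto simp: mono_def)
  then obtain L where L: "(\<lambda>m. measure_pmf.expectation \<mu> (\<lambda>x. I m x * w x)) \<longlonglongrightarrow> L"
    using bound by (meson incseq_convergent)
  show "integrable (measure_pmf \<mu>) w"
    by (rule integrable_monotone_convergence[OF int_w _ _ L]) (use mono lim in auto)
  have "measure_pmf.expectation \<mu> w = L"
    by (rule integral_monotone_convergence[OF int_w _ _ L]) (use mono lim in auto)
  then show "measure_pmf.expectation \<mu> w \<le> c / \<gamma>"
    using L bound by (auto intro: LIMSEQ_le_const2)
qed

section \<open>Contraction of the hardcore chain\<close>

text \<open>Two different active colours are at distance 2, an active and an inactive vertex at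
  distance 1. The weight of a disagreement is thus the number of colours that it can block for a
  neighbour in only one of the two configurations.\<close>

definition colour_dist :: "nat \<Rightarrow> nat \<Rightarrow> real" where
  "colour_dist a b = (if a = b then 0 else of_bool (a \<noteq> 0) + of_bool (b \<noteq> 0))"

definition config_dist :: "('v::finite \<Rightarrow> nat) \<Rightarrow> ('v \<Rightarrow> nat) \<Rightarrow> real" where
  "config_dist x y = (\<Sum>v\<in>UNIV. colour_dist (x v) (y v))"

lemma colour_dist_nonneg: "0 \<le> colour_dist a b"
  by (simp add: colour_dist_def)

lemma config_dist_bounds: "0 \<le> config_dist x y" "config_dist x y \<le> 2 * CARD('v)"
  for x y :: "'v::finite \<Rightarrow> nat"
proof -
  show "0 \<le> config_dist x y"
    by (auto simp: config_dist_def intro!: sum_nonneg colour_dist_nonneg)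
  have "config_dist x y \<le> (\<Sum>v\<in>(UNIV :: 'v set). 2)"
    unfolding config_dist_def by (intro sum_mono) (simp add: colour_dist_def)
  then show "config_dist x y \<le> 2 * CARD('v)" by simp
qed

lemma config_dist_fun_upd:
  "config_dist (x(v := a)) (y(v := b)) =
    config_dist x y - colour_dist (x v) (y v) + colour_dist a b"
  unfolding config_dist_def by (simp add: sum.remove[of UNIV v])

text \<open>The condition ranges over all maps to the naturals: the coupling estimates below never
  use properness.\<close>

definition config_lipschitz :: "real \<Rightarrow> (('v::finite \<Rightarrow> nat) \<Rightarrow> real) \<Rightarrow> bool" where
  "config_lipschitz L \<phi> \<longleftrightarrow> (\<forall>x y. \<bar>\<phi> x - \<phi> y\<bar> \<le> L * config_dist x y)"

section \<open>Coupling two configurations by common coins and colours\<close>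

definition recolour :: "'v set set \<Rightarrow> 'v \<Rightarrow> ('v \<Rightarrow> nat) \<Rightarrow> bool \<times> nat \<Rightarrow> ('v \<Rightarrow> nat)" where
  "recolour E v x = (\<lambda>(C, k).
    x(v := if C \<and> (\<forall>u. {u, v} \<in> E \<longrightarrow> x u \<noteq> k) then k else 0))"

text \<open>The randomness of an update is kept apart from the configuration, so that one draw can
  drive two configurations at once.\<close>

definition coin_colour :: "nat \<Rightarrow> real \<Rightarrow> (bool \<times> nat) pmf" where
  "coin_colour K c = pair_pmf (bernoulli_pmf c) (pmf_of_set {1..K})"

lemma mch_update_eq: "mch_update E K p v x = map_pmf (recolour E v x) (coin_colour K (p v))"
proof -
  have "(if b then x(v := k) else x(v := 0)) = x(v := if b then k else 0)" for b k
    by simp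
  then show ?thesis
    by (simp only: mch_update_def recolour_def coin_colour_def pair_pmf_def map_bind_pmf
        map_return_pmf prod.case)
qed

text \<open>Each disagreeing neighbour contributes its nonzero colours to the set of colours
  that are available at \<open>v\<close> in only one of the two configurations.\<close>

lemma card_discrepant_colours:
  fixes x y :: "'v::finite \<Rightarrow> nat"
  shows "real (card {k\<in>{1..K}. (\<forall>u. {u, v} \<in> E \<longrightarrow> x u \<noteq> k) \<noteq> (\<forall>u. {u, v} \<in> E \<longrightarrow> y u \<noteq> k)})
    \<le> (\<Sum>u | {u, v} \<in> E. colour_dist (x u) (y u))" (is "real (card ?D) \<le> _")
proof -
  define c where "c u = (if x u = y u then {} else {x u, y u} - {0})" for u
  have fin: "finite (c u)" for u by (simp add: c_def)
  have "?D \<subseteq> (\<Union>u\<in>{u. {u, v} \<in> E}. c u)"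
  proof
    fix k assume "k \<in> ?D"
    then have "(\<forall>u. {u, v} \<in> E \<longrightarrow> x u \<noteq> k) \<noteq> (\<forall>u. {u, v} \<in> E \<longrightarrow> y u \<noteq> k)" and "k \<noteq> 0"
      by simp_all
    then obtain u where u: "{u, v} \<in> E" "(x u = k) \<noteq> (y u = k)" by blast
    with \<open>k \<noteq> 0\<close> have "k \<in> c u" by (cases "x u = k") (simp_all add: c_def)
    with u(1) show "k \<in> (\<Union>u\<in>{u. {u, v} \<in> E}. c u)" by blast
  qed
  then have "card ?D \<le> card (\<Union>u\<in>{u. {u, v} \<in> E}. c u)"
    by (intro card_mono) (auto simp: fin)
  also have "\<dots> \<le> (\<Sum>u | {u, v} \<in> E. card (c u))"
    by (rule card_UN_le) simp
  finally have "real (card ?D) \<le> (\<Sum>u | {u, v} \<in> E. real (card (c u)))"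
    by (simp flip: of_nat_sum)
  also have "\<dots> = (\<Sum>u | {u, v} \<in> E. colour_dist (x u) (y u))"
    by (intro sum.cong refl) (auto simp: c_def colour_dist_def insert_Diff_if)
  finally show ?thesis .
qed

text \<open>The old disagreement at \<open>v\<close> is erased. A new one arises only if the drawn
  colour is accepted in exactly one configuration; then one colour is \<open>k\<close> and the other
  0, at distance at most 1.\<close>

lemma config_dist_recolour:
  "config_dist (recolour E v x (C, k)) (recolour E v y (C, k)) \<le>
    config_dist x y - colour_dist (x v) (y v) +
    of_bool (C \<and> (\<forall>u. {u, v} \<in> E \<longrightarrow> x u \<noteq> k) \<noteq> (\<forall>u. {u, v} \<in> E \<longrightarrow> y u \<noteq> k))"
  unfolding recolour_def prod.case config_dist_fun_upd
  by (rule add_left_mono) (auto simp: colour_dist_def)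

lemma finite_set_coin_colour: "1 \<le> K \<Longrightarrow> finite (set_pmf (coin_colour K c))"
  by (simp add: coin_colour_def)

lemma expectation_coin_colour:
  assumes "1 \<le> K" "0 \<le> c" "c \<le> 1"
  shows "measure_pmf.expectation (coin_colour K c) (\<lambda>(C, k). of_bool (C \<and> k \<in> D)) =
    c * (real (card (D \<inter> {1..K})) / real K)"
proof -
  have "measure_pmf.expectation (coin_colour K c) (\<lambda>z. of_bool (fst z \<and> snd z \<in> D)) =
      measure_pmf.expectation (coin_colour K c) (indicator ({True} \<times> D))"
    by (intro Bochner_Integration.integral_cong) (auto simp: indicator_def)
  also have "\<dots> = c * (real (card (D \<inter> {1..K})) / real K)"
    unfolding coin_colour_def using assms
    by (simp add: measure_pmf_prob_product measure_pmf_single measure_pmf_of_set Int_commute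
        countable_subset)
  finally show ?thesis by (simp add: case_prod_unfold)
qed

text \<open>Both expectations are taken over the same draw. A new disagreement at \<open>v\<close>
  needs a successful coin and one of the discrepant colours among \<open>K\<close>, whose number is
  bounded by the distances at the neighbours.\<close>

lemma config_lipschitz_update:
  fixes \<phi> :: "('v::finite \<Rightarrow> nat) \<Rightarrow> real"
  assumes \<phi>: "config_lipschitz L \<phi>" and L: "0 \<le> L" and K: "1 \<le> K" and p: "0 \<le> p v" "p v \<le> 1"
  shows "\<bar>measure_pmf.expectation (mch_update E K p v x) \<phi> -
      measure_pmf.expectation (mch_update E K p v y) \<phi>\<bar> \<le>
    L * (config_dist x y - colour_dist (x v) (y v) +
      p v / real K * (\<Sum>u | {u, v} \<in> E. colour_dist (x u) (y u)))"
proof -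
  let ?E = "measure_pmf.expectation (coin_colour K (p v))"
  define D where "D = {k. (\<forall>u. {u, v} \<in> E \<longrightarrow> x u \<noteq> k) \<noteq> (\<forall>u. {u, v} \<in> E \<longrightarrow> y u \<noteq> k)}"
  have int: "integrable (measure_pmf (coin_colour K (p v))) g" for g :: "bool \<times> nat \<Rightarrow> real"
    by (rule integrable_measure_pmf_finite) (rule finite_set_coin_colour[OF K])
  have pt: "\<bar>\<phi> (recolour E v x z) - \<phi> (recolour E v y z)\<bar> \<le>
      L * (config_dist x y - colour_dist (x v) (y v) + (case z of (C, k) \<Rightarrow> of_bool (C \<and> k \<in> D)))"
    for z
  proof (cases z)
    case (Pair C k)
    have "\<bar>\<phi> (recolour E v x z) - \<phi> (recolour E v y z)\<bar> \<le>
        L * config_dist (recolour E v x z) (recolour E v y z)"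
      using \<phi> by (simp add: config_lipschitz_def)
    also have "\<dots> \<le> L * (config_dist x y - colour_dist (x v) (y v) +
        (case z of (C, k) \<Rightarrow> of_bool (C \<and> k \<in> D)))"
      unfolding Pair prod.case D_def mem_Collect_eq
      by (intro mult_left_mono config_dist_recolour L)
    finally show ?thesis .
  qed
  have "\<bar>measure_pmf.expectation (mch_update E K p v x) \<phi> -
      measure_pmf.expectation (mch_update E K p v y) \<phi>\<bar> =
      \<bar>?E (\<lambda>z. \<phi> (recolour E v x z) - \<phi> (recolour E v y z))\<bar>"
    by (simp add: mch_update_eq int)
  also have "\<dots> \<le> ?E (\<lambda>z. \<bar>\<phi> (recolour E v x z) - \<phi> (recolour E v y z)\<bar>)"
    by (rule integral_abs_bound)
  also have "\<dots> \<le> ?E (\<lambda>z. L * (config_dist x y - colour_dist (x v) (y v) +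
      (case z of (C, k) \<Rightarrow> of_bool (C \<and> k \<in> D))))"
    by (intro integral_mono int pt)
  also have "\<dots> = L * (config_dist x y - colour_dist (x v) (y v) +
      ?E (\<lambda>(C, k). of_bool (C \<and> k \<in> D)))"
    by (simp add: int)
  also have "\<dots> \<le> L * (config_dist x y - colour_dist (x v) (y v) +
      p v / real K * (\<Sum>u | {u, v} \<in> E. colour_dist (x u) (y u)))"
  proof (intro mult_left_mono add_left_mono L)
    have "D \<inter> {1..K} =
        {k\<in>{1..K}. (\<forall>u. {u, v} \<in> E \<longrightarrow> x u \<noteq> k) \<noteq> (\<forall>u. {u, v} \<in> E \<longrightarrow> y u \<noteq> k)}"
      by (auto simp: D_def)
    then have "real (card (D \<inter> {1..K})) \<le> (\<Sum>u | {u, v} \<in> E. colour_dist (x u) (y u))"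
      by (simp only: card_discrepant_colours)
    then have "p v / real K * real (card (D \<inter> {1..K})) \<le>
        p v / real K * (\<Sum>u | {u, v} \<in> E. colour_dist (x u) (y u))"
      using p by (intro mult_left_mono) auto
    then show "?E (\<lambda>(C, k). of_bool (C \<and> k \<in> D)) \<le>
        p v / real K * (\<Sum>u | {u, v} \<in> E. colour_dist (x u) (y u))"
      unfolding expectation_coin_colour[OF K p] by simp
  qed
  finally show ?thesis .
qed

text \<open>When the rates sum to \<open>CARD('v)\<close>, this is the transition operator
  \<open>T\<close> of the uniformised discrete-time chain, and the generator of the hardcore chain
  is \<open>CARD('v) * (T - id)\<close>.\<close>

definition mch_step :: "'v::finite set set \<Rightarrow> nat \<Rightarrow> ('v \<Rightarrow> real) \<Rightarrow> ('v \<Rightarrow> real) \<Rightarrow>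
    (('v \<Rightarrow> nat) \<Rightarrow> real) \<Rightarrow> ('v \<Rightarrow> nat) \<Rightarrow> real" where
  "mch_step E K lam p \<phi> x =
    (\<Sum>v\<in>UNIV. lam v * measure_pmf.expectation (mch_update E K p v x) \<phi>) / real CARD('v)"

lemma sum_neighbours_swap:
  fixes g :: "'v::finite \<Rightarrow> real"
  shows "(\<Sum>v\<in>UNIV. \<Sum>u | {u, v} \<in> E. g u) = (\<Sum>u\<in>UNIV. real (vertex_degree E u) * g u)"
proof -
  have "(\<Sum>v\<in>UNIV. \<Sum>u | {u, v} \<in> E. g u) = (\<Sum>u\<in>UNIV. \<Sum>v | {u, v} \<in> E. g u)"
    using sum.swap_restrict[of UNIV UNIV "\<lambda>v u. g u" "\<lambda>v u. {u, v} \<in> E"] by simp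
  then show ?thesis by (simp add: vertex_degree_def insert_commute)
qed

lemma min_degree_le: "min_degree E \<le> vertex_degree E v"
  by (simp add: min_degree_def)

lemma min_degree_le_avg_degree: "real (min_degree E) \<le> avg_degree E"
  for E :: "'v::finite set set"
proof -
  have "(\<Sum>v\<in>(UNIV :: 'v set). real (min_degree E)) \<le> (\<Sum>v\<in>UNIV. real (vertex_degree E v))"
    by (intro sum_mono) (simp add: min_degree_le)
  then show ?thesis by (simp add: avg_degree_def field_simps)
qed

lemma sum_degree_over_avg_degree:
  fixes E :: "'v::finite set set"
  assumes "1 \<le> min_degree E" and "\<forall>v. lam v = real (vertex_degree E v) / avg_degree E"
  shows "(\<Sum>v\<in>UNIV. lam v) = real CARD('v)"
proof -
  have "(\<Sum>v\<in>UNIV. lam v) = (\<Sum>v\<in>UNIV. real (vertex_degree E v)) / avg_degree E"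
    by (simp add: assms(2) sum_divide_distrib)
  also have "(\<Sum>v\<in>UNIV. real (vertex_degree E v)) = real CARD('v) * avg_degree E"
    by (simp add: avg_degree_def)
  finally show ?thesis using assms(1) min_degree_le_avg_degree[of E] by simp
qed

text \<open>A vertex of disagreement \<open>u\<close> is removed at rate \<open>d\<^sub>u\<close> and spreads to its neighbours at
  total rate at most \<open>2 / 3 * d\<^sub>u\<close>, both in units of \<open>1 / avg_degree E\<close>.\<close>

lemma config_lipschitz_mch_step:
  fixes E :: "'v::finite set set"
  assumes deg: "1 \<le> min_degree E" and K: "1 \<le> K"
    and p: "\<forall>v. 0 \<le> p v \<and> p v \<le> 1" "\<forall>v. p v \<le> 2 / 3 * real K / real (vertex_degree E v)"
    and lam: "\<forall>v. lam v = real (vertex_degree E v) / avg_degree E"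
    and \<phi>: "config_lipschitz L \<phi>" and L: "0 \<le> L"
  shows "config_lipschitz
    (L * (1 - real (min_degree E) / (3 * avg_degree E * real CARD('v)))) (mch_step E K lam p \<phi>)"
  unfolding config_lipschitz_def
proof (intro allI)
  fix x y :: "'v \<Rightarrow> nat"
  define n where "n = real CARD('v)"
  define d where "d v = real (vertex_degree E v)" for v
  define a where "a = avg_degree E"
  define D where "D v = colour_dist (x v) (y v)" for v
  define \<rho> where "\<rho> = config_dist x y"
  let ?T = "\<lambda>x v. measure_pmf.expectation (mch_update E K p v x) \<phi>"
  have n: "0 < n" by (simp add: n_def)
  have a: "0 < a" using min_degree_le_avg_degree[of E] deg by (simp add: a_def)
  have d: "real (min_degree E) \<le> d v" for v by (simp add: d_def min_degree_le)
  have d_pos: "0 < d v" for v using d[of v] deg by simp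
  have D: "0 \<le> D v" for v by (simp add: D_def colour_dist_nonneg)
  have sum_d: "(\<Sum>v\<in>UNIV. d v) = a * n" by (simp add: a_def avg_degree_def n_def d_def)
  have \<rho>: "\<rho> = (\<Sum>v\<in>UNIV. D v)" by (simp add: \<rho>_def config_dist_def D_def)
  have v: "lam v * \<bar>?T x v - ?T y v\<bar> \<le>
      L * (d v / a * (\<rho> - D v) + 2 / 3 / a * (\<Sum>u | {u, v} \<in> E. D u))" for v
  proof -
    have "p v \<le> 2 / 3 * real K / d v" using p(2) by (simp only: d_def)
    then have "p v / real K \<le> 2 / 3 / d v"
      using K by (simp add: pos_divide_le_eq mult.commute)
    moreover have "0 \<le> (\<Sum>u | {u, v} \<in> E. D u)" by (intro sum_nonneg D)
    ultimately have "p v / real K * (\<Sum>u | {u, v} \<in> E. D u) \<le>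
        2 / 3 / d v * (\<Sum>u | {u, v} \<in> E. D u)"
      by (rule mult_right_mono)
    then have "L * (\<rho> - D v + p v / real K * (\<Sum>u | {u, v} \<in> E. D u)) \<le>
        L * (\<rho> - D v + 2 / 3 / d v * (\<Sum>u | {u, v} \<in> E. D u))"
      using L by (intro mult_left_mono) auto
    with config_lipschitz_update[OF \<phi> L K, of p v E x y]
    have "\<bar>?T x v - ?T y v\<bar> \<le> L * (\<rho> - D v + 2 / 3 / d v * (\<Sum>u | {u, v} \<in> E. D u))"
      using p(1) by (simp add: \<rho>_def D_def)
    then have "d v / a * \<bar>?T x v - ?T y v\<bar> \<le>
        d v / a * (L * (\<rho> - D v + 2 / 3 / d v * (\<Sum>u | {u, v} \<in> E. D u)))"
      using d_pos[of v] a by (intro mult_left_mono) auto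
    \<comment> \<open>The update rate, proportional to \<open>d v\<close>, cancels the
      \<open>1 / d v\<close> from the bound on \<open>p v\<close>. The neighbour terms now carry the
      same weight at every \<open>v\<close>, so the double sum can be exchanged.\<close>
    also have "\<dots> = L * (d v / a * (\<rho> - D v) + 2 / 3 / a * (\<Sum>u | {u, v} \<in> E. D u))"
      using d_pos[of v] a by (simp add: field_simps)
    finally show ?thesis using lam by (simp add: d_def a_def)
  qed
  have "mch_step E K lam p \<phi> x - mch_step E K lam p \<phi> y =
      (\<Sum>v\<in>UNIV. lam v * (?T x v - ?T y v)) / n"
    unfolding mch_step_def n_def by (simp add: right_diff_distrib sum_subtractf diff_divide_distrib)
  then have "n * \<bar>mch_step E K lam p \<phi> x - mch_step E K lam p \<phi> y\<bar> =
      \<bar>\<Sum>v\<in>UNIV. lam v * (?T x v - ?T y v)\<bar>"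
    using n by simp
  also have "\<dots> \<le> (\<Sum>v\<in>UNIV. \<bar>lam v * (?T x v - ?T y v)\<bar>)"
    by (rule sum_abs)
  also have "\<dots> = (\<Sum>v\<in>UNIV. lam v * \<bar>?T x v - ?T y v\<bar>)"
    using d_pos a lam by (simp add: abs_mult d_def[symmetric] a_def[symmetric] less_imp_le)
  also have "\<dots> \<le> (\<Sum>v\<in>UNIV. L * (d v / a * (\<rho> - D v) + 2 / 3 / a * (\<Sum>u | {u, v} \<in> E. D u)))"
    by (intro sum_mono v)
  also have "\<dots> = L * ((\<Sum>v\<in>UNIV. d v) * \<rho> / a - (\<Sum>v\<in>UNIV. d v * D v) / a +
      2 / 3 / a * (\<Sum>v\<in>UNIV. \<Sum>u | {u, v} \<in> E. D u))"
    unfolding sum_distrib_left[symmetric, of L]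
    by (simp add: sum.distrib sum_subtractf right_diff_distrib diff_divide_distrib
        flip: sum_distrib_left sum_distrib_right sum_divide_distrib)
  \<comment> \<open>After the exchange each \<open>u\<close> is counted once per neighbour. Removal
    and spreading then combine to \<open>- 1 + 2 / 3 = - 1 / 3\<close> times the degree-weighted
    distance.\<close>
  also have "\<dots> = L * (n * \<rho> - (\<Sum>v\<in>UNIV. d v * D v) / (3 * a))"
    using a by (simp add: sum_d sum_neighbours_swap d_def[symmetric] field_simps)
  also have "\<dots> \<le> L * (n * \<rho> - real (min_degree E) * \<rho> / (3 * a))"
  proof -
    have "real (min_degree E) * \<rho> \<le> (\<Sum>v\<in>UNIV. d v * D v)"
      unfolding \<rho> sum_distrib_left by (intro sum_mono mult_right_mono d D)
    then show ?thesis
      using L a by (intro mult_left_mono diff_left_mono divide_right_mono) auto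
  qed
  also have "\<dots> = n * (L * (1 - real (min_degree E) / (3 * a * n)) * \<rho>)"
    using a n by (simp add: field_simps)
  finally show "\<bar>mch_step E K lam p \<phi> x - mch_step E K lam p \<phi> y\<bar> \<le>
      L * (1 - real (min_degree E) / (3 * avg_degree E * real CARD('v))) * config_dist x y"
    using n by (simp add: n_def a_def \<rho>_def)
qed

section \<open>The Poisson equation\<close>

lemma mch_update_states:
  assumes "simple_graph E" and K: "1 \<le> K" and x: "x \<in> mch_states E K"
  shows "set_pmf (mch_update E K p v x) \<subseteq> mch_states E K"
proof -
  have loop: "{v, v} \<notin> E" using assms(1) by (auto simp: simple_graph_def)
  have "x(v := k) \<in> mch_states E K" if "k \<le> K" "k = 0 \<or> (\<forall>u. {u, v} \<in> E \<longrightarrow> x u \<noteq> k)" for k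
    using x that loop unfolding mch_states_def proper_def
    by (auto simp: insert_commute)
  then show ?thesis
    using K by (auto simp: mch_update_eq recolour_def coin_colour_def)
qed

lemma finite_set_mch_update: "1 \<le> K \<Longrightarrow> finite (set_pmf (mch_update E K p v x))"
  by (simp add: mch_update_eq finite_set_coin_colour)

lemma integrable_mch_update:
  fixes g :: "('v \<Rightarrow> nat) \<Rightarrow> real"
  shows "1 \<le> K \<Longrightarrow> integrable (measure_pmf (mch_update E K p v x)) g"
  by (simp add: integrable_measure_pmf_finite finite_set_mch_update)

text \<open>The sum includes the diagonal, that is, updates that change nothing. In the generator
  these are multiplied by \<open>\<phi> x - \<phi> x\<close>, so the formula can be used there
  directly.\<close>

lemma sum_mch_rate:
  fixes E :: "'v::finite set set"
  assumes "simple_graph E" "1 \<le> K" "x \<in> mch_states E K"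
  shows "(\<Sum>y\<in>mch_states E K. mch_rate E K lam p x y * h y) =
    (\<Sum>v\<in>UNIV. lam v * measure_pmf.expectation (mch_update E K p v x) h)"
proof -
  have e: "measure_pmf.expectation (mch_update E K p v x) h =
      (\<Sum>y\<in>mch_states E K. pmf (mch_update E K p v x) y * h y)" for v
    using mch_update_states[OF assms]
    by (subst integral_measure_pmf[OF finite_mch_states[of E K]]) auto
  show ?thesis
    unfolding mch_rate_def e sum_distrib_left sum_distrib_right
    by (subst sum.swap) (simp only: mult.assoc)
qed

lemma mch_rate_nonneg: "(\<forall>v. 0 \<le> lam v) \<Longrightarrow> 0 \<le> mch_rate E K lam p x y"
  unfolding mch_rate_def by (intro sum_nonneg mult_nonneg_nonneg) auto

text \<open>The continuous-time equilibrium is also invariant for the uniformised chain, because the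
  generator is a multiple of the step minus the identity and has mean 0.\<close>

lemma expectation_mch_step:
  fixes E :: "'v::finite set set"
  assumes E: "simple_graph E" and K: "1 \<le> K" and lam: "\<forall>v. 0 \<le> lam v" "(\<Sum>v\<in>UNIV. lam v) = real CARD('v)"
    and eq: "mch_equilibrium E K lam p \<pi>" and B: "\<And>y. \<bar>\<phi> y\<bar> \<le> B"
  shows "measure_pmf.expectation \<pi> (mch_step E K lam p \<phi>) = measure_pmf.expectation \<pi> \<phi>"
proof -
  let ?S = "mch_states E K" and ?r = "mch_rate E K lam p"
  obtain P where P: "set_pmf \<pi> \<subseteq> ?S" "transition_semigroup ?S ?r P"
      "\<And>t. 0 \<le> t \<Longrightarrow> bind_pmf \<pi> (P t) = \<pi>"
    using eq by (auto simp: mch_equilibrium_def invariant_distribution_def)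
  have fin: "finite (set_pmf \<pi>)" using P(1) finite_mch_states by (rule finite_subset)
  have R: "(\<Sum>y\<in>?S - {x}. ?r x y) \<le> real CARD('v)" if "x \<in> ?S" for x
  proof -
    have "(\<Sum>y\<in>?S - {x}. ?r x y) \<le> (\<Sum>y\<in>?S. ?r x y * 1)"
      using lam(1) by (simp add: sum_mono2 finite_mch_states mch_rate_nonneg)
    then show ?thesis by (simp only: sum_mch_rate[OF E K that]) (simp add: lam)
  qed
  have "measure_pmf.expectation \<pi> (\<lambda>x. \<Sum>y\<in>?S. ?r x y * (\<phi> y - \<phi> x)) = 0"
    by (rule stationary_generator(2)[OF P(2,1,3), where R = "real CARD('v)" and B = B])
      (auto simp: finite_mch_states R B)
  also have "measure_pmf.expectation \<pi> (\<lambda>x. \<Sum>y\<in>?S. ?r x y * (\<phi> y - \<phi> x)) =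
      measure_pmf.expectation \<pi> (\<lambda>x. real CARD('v) * (mch_step E K lam p \<phi> x - \<phi> x))"
  proof (intro integral_cong_AE, simp_all only: AE_measure_pmf_iff, simp, simp, intro ballI)
    fix x assume "x \<in> set_pmf \<pi>"
    with P(1) have x: "x \<in> ?S" by auto
    show "(\<Sum>y\<in>?S. ?r x y * (\<phi> y - \<phi> x)) = real CARD('v) * (mch_step E K lam p \<phi> x - \<phi> x)"
      unfolding sum_mch_rate[OF E K x]
      by (simp add: integrable_mch_update[OF K] mch_step_def
          right_diff_distrib sum_subtractf lam(2) flip: sum_distrib_right)
  qed
  finally show ?thesis
    by (simp add: integrable_measure_pmf_finite fin)
qed

lemma mch_step_affine:
  fixes E :: "'v::finite set set"
  assumes K: "1 \<le> K" and lam: "(\<Sum>v\<in>UNIV. lam v) = real CARD('v)" and A: "finite A"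
  shows "mch_step E K lam p (\<lambda>x. a * (\<Sum>k\<in>A. \<phi> k x) + b) x =
    a * (\<Sum>k\<in>A. mch_step E K lam p (\<phi> k) x) + b"
proof -
  have "measure_pmf.expectation (mch_update E K p v x) (\<lambda>x. a * (\<Sum>k\<in>A. \<phi> k x) + b) =
      a * (\<Sum>k\<in>A. measure_pmf.expectation (mch_update E K p v x) (\<phi> k)) + b" for v
    by (simp add: integrable_mch_update[OF K])
  then have "mch_step E K lam p (\<lambda>x. a * (\<Sum>k\<in>A. \<phi> k x) + b) x =
      (\<Sum>v\<in>UNIV. a * (\<Sum>k\<in>A. lam v * measure_pmf.expectation (mch_update E K p v x) (\<phi> k)) + lam v * b)
        / real CARD('v)"
    unfolding mch_step_def by (simp add: distrib_left sum_distrib_left mult.left_commute)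
  also have "(\<Sum>v\<in>UNIV. a * (\<Sum>k\<in>A. lam v * measure_pmf.expectation (mch_update E K p v x) (\<phi> k)) + lam v * b) =
      a * (\<Sum>k\<in>A. \<Sum>v\<in>UNIV. lam v * measure_pmf.expectation (mch_update E K p v x) (\<phi> k)) + real CARD('v) * b"
    unfolding sum.distrib sum_distrib_right[symmetric] sum_distrib_left[of a, symmetric] lam
    by (subst sum.swap) (rule refl)
  finally show ?thesis
    by (simp add: mch_step_def add_divide_distrib flip: sum_divide_distrib)
qed

lemma service_rate_eq:
  fixes E :: "'v::finite set set"
  assumes "set_pmf \<pi> \<subseteq> mch_states E K"
  shows "service_rate E K \<pi> v = measure_pmf.expectation \<pi> (\<lambda>x. of_bool (x v \<noteq> 0))"
proof -
  have "measure_pmf.expectation \<pi> (\<lambda>x. of_bool (x v \<noteq> 0) :: real) =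
      (\<Sum>x\<in>mch_states E K. pmf \<pi> x * of_bool (x v \<noteq> 0))"
    using assms by (subst integral_measure_pmf[OF finite_mch_states[of E K]]) auto
  also have "\<dots> = (\<Sum>x\<in>{x \<in> mch_states E K. x v \<noteq> 0}. pmf \<pi> x)"
    by (intro sum.mono_neutral_cong_right finite_mch_states) auto
  finally show ?thesis by (simp add: service_rate_def)
qed

text \<open>With the semigroup of the chain replaced by the powers of \<open>mch_step\<close>, the partial sums of
  the Neumann series solve the Poisson equation up to an error that decays geometrically.\<close>

lemma mch_poisson_approx:
  fixes E :: "'v::finite set set"
  assumes E: "simple_graph E" and deg: "1 \<le> min_degree E" and K: "1 \<le> K"
    and p: "\<forall>v. 0 \<le> p v \<and> p v \<le> 1" "\<forall>v. p v \<le> 2 / 3 * real K / real (vertex_degree E v)"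
    and lam: "\<forall>v. lam v = real (vertex_degree E v) / avg_degree E"
    and eq: "mch_equilibrium E K lam p \<pi>" and \<epsilon>: "0 < \<epsilon>"
  obtains g where
    "\<And>x. 0 \<le> g x" "\<And>x. g x \<le> 6 * avg_degree E * real CARD('v) / real (min_degree E)"
    "\<And>x. real CARD('v) * (mch_step E K lam p g x - g x) \<le>
      of_bool (x v \<noteq> 0) - service_rate E K \<pi> v + \<epsilon>"
proof -
  define n where "n = real CARD('v)"
  define \<theta> where "\<theta> = real (min_degree E) / (3 * avg_degree E * n)"
  define T where "T = mch_step E K lam p"
  define f :: "('v \<Rightarrow> nat) \<Rightarrow> real" where "f x = of_bool (x v \<noteq> 0)" for x
  define U where "U k = (T ^^ k) f" for k
  define s where "s = service_rate E K \<pi> v"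
  have n: "1 \<le> n" by (simp add: n_def Suc_le_eq)
  have a: "real (min_degree E) \<le> avg_degree E" by (rule min_degree_le_avg_degree)
  with deg have a_pos: "0 < avg_degree E" by simp
  have \<theta>: "0 < \<theta>" using deg a_pos n by (simp add: \<theta>_def)
  have "real (min_degree E) * 1 \<le> avg_degree E * (3 * n)"
    using a a_pos n by (intro mult_mono) auto
  then have \<theta>1: "\<theta> \<le> 1" using a_pos n by (simp add: \<theta>_def field_simps)
  have lam_nonneg: "\<forall>v. 0 \<le> lam v" using lam a_pos by simp
  have lam_sum: "(\<Sum>v\<in>UNIV. lam v) = real CARD('v)"
    using deg lam by (rule sum_degree_over_avg_degree)
  have supp: "set_pmf \<pi> \<subseteq> mch_states E K"
    using eq by (simp add: mch_equilibrium_def invariant_distribution_def)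
  have "config_lipschitz 1 f"
    unfolding config_lipschitz_def
  proof (intro allI)
    fix x y
    have "\<bar>f x - f y\<bar> \<le> colour_dist (x v) (y v)" by (simp add: f_def colour_dist_def)
    also have "\<dots> \<le> config_dist x y"
      unfolding config_dist_def by (rule member_le_sum) (auto simp: colour_dist_nonneg)
    finally show "\<bar>f x - f y\<bar> \<le> 1 * config_dist x y" by simp
  qed
  then have lip: "config_lipschitz ((1 - \<theta>) ^ k) (U k)" for k
  proof (induction k)
    case (Suc k)
    show ?case
      using config_lipschitz_mch_step[OF deg K p lam Suc.IH[OF Suc.prems]] \<theta>1
      by (simp add: U_def T_def \<theta>_def n_def mult.commute)
  qed (simp add: U_def)
  have osc: "\<bar>U k x - U k y\<bar> \<le> (1 - \<theta>) ^ k * (2 * n)" for k x y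
  proof -
    have "\<bar>U k x - U k y\<bar> \<le> (1 - \<theta>) ^ k * config_dist x y"
      using lip by (simp add: config_lipschitz_def)
    also have "\<dots> \<le> (1 - \<theta>) ^ k * (2 * n)"
      using \<theta>1 config_dist_bounds[of x y] by (intro mult_left_mono) (auto simp: n_def)
    finally show ?thesis .
  qed
  \<comment> \<open>Invariance is stated for bounded functions, while \<open>osc\<close> only
    controls differences; \<open>undefined\<close> serves as an arbitrary reference
    configuration.\<close>
  have U_bound: "\<bar>U k x\<bar> \<le> \<bar>U k undefined\<bar> + (1 - \<theta>) ^ k * (2 * n)" for k x
    using osc[of k x undefined] by linarith
  have fin: "finite (set_pmf \<pi>)" using supp finite_mch_states by (rule finite_subset)
  have EU: "measure_pmf.expectation \<pi> (U k) = s" for k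
  proof (induction k)
    case 0
    show ?case by (simp add: U_def s_def service_rate_eq[OF supp] f_def[abs_def])
  next
    case (Suc k)
    then show ?case
      using expectation_mch_step[OF E K lam_nonneg lam_sum eq U_bound[of k]]
      by (simp add: U_def T_def)
  qed
  \<comment> \<open>The equilibrium mean of \<open>U k\<close> is \<open>s\<close>, so no value of
    \<open>U k\<close> is further from \<open>s\<close> than its oscillation.\<close>
  have Us: "s - U k x \<le> (1 - \<theta>) ^ k * (2 * n)" "U k x - s \<le> (1 - \<theta>) ^ k * (2 * n)" for k x
  proof -
    have "s - U k x = measure_pmf.expectation \<pi> (\<lambda>y. U k y - U k x)"
      by (simp add: EU integrable_measure_pmf_finite fin)
    also have "\<bar>\<dots>\<bar> \<le> (1 - \<theta>) ^ k * (2 * n)"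
      by (rule order_trans[OF integral_abs_bound], rule measure_pmf.integral_le_const)
        (auto simp: integrable_measure_pmf_finite fin osc)
    finally show "s - U k x \<le> (1 - \<theta>) ^ k * (2 * n)" "U k x - s \<le> (1 - \<theta>) ^ k * (2 * n)"
      by auto
  qed
  have "(\<lambda>k. (1 - \<theta>) ^ k * (2 * n)) \<longlonglongrightarrow> 0 * (2 * n)"
    using \<theta> \<theta>1 by (intro tendsto_mult LIMSEQ_power_zero tendsto_const) auto
  then have "\<forall>\<^sub>F k in sequentially. (1 - \<theta>) ^ k * (2 * n) < \<epsilon>"
    using \<epsilon> by (auto dest: order_tendstoD(2)[where a = \<epsilon>])
  then obtain N where N: "(1 - \<theta>) ^ N * (2 * n) < \<epsilon>"
    by (auto simp: eventually_sequentially)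
  \<comment> \<open>The sign and the factor \<open>1 / n\<close> make the sum telescope to
    \<open>n * (T G - G) = f - U N\<close>, and \<open>N\<close> was chosen so that
    \<open>U N\<close> is within \<open>\<epsilon>\<close> of \<open>s\<close>.\<close>
  define G where "G x = - 1 / n * (\<Sum>k<N. U k x)" for x
  \<comment> \<open>The diameter \<open>2 * n\<close> times the geometric series
    \<open>1 / \<theta>\<close>, divided by \<open>n\<close>.\<close>
  have G: "G x - G y \<le> 2 / \<theta>" for x y
  proof -
    have "G x - G y = (\<Sum>k<N. U k y - U k x) / n"
      by (simp add: G_def sum_subtractf diff_divide_distrib)
    also have "\<dots> \<le> (\<Sum>k<N. (1 - \<theta>) ^ k * (2 * n)) / n"
      using n osc by (intro divide_right_mono sum_mono) (auto simp: abs_le_iff)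
    also have "\<dots> = 2 * (\<Sum>k<N. (1 - \<theta>) ^ k)"
      using n by (simp flip: sum_distrib_right)
    also have "\<dots> = 2 * ((1 - (1 - \<theta>) ^ N) / \<theta>)"
      using \<theta> by (simp add: sum_gp_strict)
    also have "\<dots> \<le> 2 * (1 / \<theta>)"
      using \<theta> \<theta>1 by (intro mult_left_mono divide_right_mono) auto
    finally show ?thesis by simp
  qed
  \<comment> \<open>Subtracting a constant does not affect the Poisson equation; with the infimum
    the oscillation bound becomes a bound between 0 and \<open>2 / \<theta>\<close>.\<close>
  define b where "b = Inf (range G)"
  have bdd: "bdd_below (range G)"
    using G[of undefined]
    by (intro bdd_belowI2[where m = "G undefined - 2 / \<theta>"]) (simp add: algebra_simps)
  show thesis
  proof (rule that[of "\<lambda>x. G x - b"])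
    fix x
    show "0 \<le> G x - b" using bdd by (simp add: b_def cInf_lower)
    have "G x - 2 / \<theta> \<le> b"
      unfolding b_def using G[of x] by (intro cInf_greatest) (auto simp: algebra_simps)
    moreover have "2 / \<theta> = 6 * avg_degree E * n / real (min_degree E)"
      by (simp add: \<theta>_def)
    ultimately show "G x - b \<le> 6 * avg_degree E * real CARD('v) / real (min_degree E)"
      by (simp add: n_def)
    have "T (\<lambda>x. G x - b) x = - 1 / n * (\<Sum>k<N. T (U k) x) - b"
      using mch_step_affine[OF K lam_sum, of "{..<N}" E p "- 1 / n" U "- b" x]
      by (simp add: T_def G_def)
    also have "\<dots> - (G x - b) = - 1 / n * (\<Sum>k<N. U (Suc k) x - U k x)"
      by (simp add: G_def U_def sum_subtractf diff_divide_distrib)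
    also have "(\<Sum>k<N. U (Suc k) x - U k x) = U N x - f x"
      by (subst sum_lessThan_telescope) (simp add: U_def)
    finally have "n * (T (\<lambda>x. G x - b) x - (G x - b)) = f x - U N x"
      using n by simp
    also have "\<dots> \<le> f x - s + \<epsilon>"
      using Us(1)[of N x] N by simp
    finally show "real CARD('v) * (mch_step E K lam p (\<lambda>x. G x - b) x - (G x - b)) \<le>
        of_bool (x v \<noteq> 0) - service_rate E K \<pi> v + \<epsilon>"
      by (simp add: n_def T_def f_def s_def)
  qed
qed

section \<open>Drift of the queueing network\<close>

text \<open>A finite set outside which the rates vanish. For an empty queue, truncated subtraction
  gives back \<open>(x, q)\<close>, which belongs to the set in any case when \<open>x\<close> is a
  hardcore state.\<close>

definition qmch_targets :: "'v::finite set set \<Rightarrow> nat \<Rightarrow> ('v \<Rightarrow> nat) \<times> ('v \<Rightarrow> nat) \<Rightarrow>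
    (('v \<Rightarrow> nat) \<times> ('v \<Rightarrow> nat)) set" where
  "qmch_targets E K = (\<lambda>(x, q). mch_states E K \<times> {q} \<union>
    range (\<lambda>u. (x, q(u := q u + 1))) \<union> range (\<lambda>u. (x, q(u := q u - 1))))"

lemma qmch_targets:
  assumes "z \<in> qmch_states E K"
  shows "finite (qmch_targets E K z)" "qmch_targets E K z \<subseteq> qmch_states E K"
    "z \<in> qmch_targets E K z"
  using assms by (auto simp: qmch_targets_def qmch_states_def finite_mch_states)

lemma qmch_rate_outside:
  assumes "z \<in> qmch_states E K" "y \<in> qmch_states E K - qmch_targets E K z"
  shows "qmch_rate E K lam p nu mu z y = 0"
proof -
  obtain x q x' q' where zy: "z = (x, q)" "y = (x', q')" by (cases z; cases y)
  have "(q' = q) = False" "\<And>u. (x' = x \<and> q' = q(u := q u + 1)) = False"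
      "\<And>u. (x' = x \<and> 1 \<le> q u \<and> q' = q(u := q u - 1)) = False"
    using assms by (auto simp: zy qmch_targets_def qmch_states_def)
  then show ?thesis
    by (simp only: zy qmch_rate_def prod.case if_False sum.neutral_const add_0_left)
qed

lemma qmch_rate_nonneg:
  "\<forall>v. 0 \<le> lam v \<Longrightarrow> \<forall>v. 0 \<le> nu v \<Longrightarrow> \<forall>v. 0 \<le> mu v \<Longrightarrow> 0 \<le> qmch_rate E K lam p nu mu z y"
  by (auto simp: qmch_rate_def case_prod_unfold intro!: add_nonneg_nonneg sum_nonneg mch_rate_nonneg)

lemma sum_qmch_rate:
  fixes E :: "'v::finite set set"
  assumes E: "simple_graph E" and K: "1 \<le> K" and x: "x \<in> mch_states E K"
  shows "(\<Sum>y\<in>qmch_targets E K (x, q). qmch_rate E K lam p nu mu (x, q) y * h y) =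
    (\<Sum>u\<in>UNIV. lam u * measure_pmf.expectation (mch_update E K p u x) (\<lambda>x'. h (x', q))) +
    (\<Sum>u\<in>UNIV. nu u * h (x, q(u := q u + 1))) +
    (\<Sum>u\<in>UNIV. if 1 \<le> q u \<and> x u \<noteq> 0 then mu u * h (x, q(u := q u - 1)) else 0)"
proof -
  let ?F = "qmch_targets E K (x, q)"
  have fin: "finite ?F" using x by (intro qmch_targets) (simp add: qmch_states_def)
  have "(\<Sum>y\<in>?F. (if snd y = q then mch_rate E K lam p x (fst y) else 0) * h y) =
      (\<Sum>y\<in>(\<lambda>x'. (x', q)) ` mch_states E K. mch_rate E K lam p x (fst y) * h y)"
    using x by (intro sum.mono_neutral_cong_right fin) (auto simp: qmch_targets_def split: if_splits)
  also have "\<dots> = (\<Sum>x'\<in>mch_states E K. mch_rate E K lam p x x' * h (x', q))"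
    by (subst sum.reindex) (auto simp: inj_on_def)
  also have "\<dots> = (\<Sum>u\<in>UNIV. lam u * measure_pmf.expectation (mch_update E K p u x) (\<lambda>x'. h (x', q)))"
    by (rule sum_mch_rate[OF E K x])
  finally have 1: "(\<Sum>y\<in>?F. (if snd y = q then mch_rate E K lam p x (fst y) else 0) * h y) = \<dots>" .
  \<comment> \<open>The map \<open>t\<close> need not be injective: departures from several empty
    queues share the target \<open>(x, q)\<close>. The sum over \<open>u\<close> therefore stays
    inside.\<close>
  have single: "(\<Sum>y\<in>?F. (\<Sum>u\<in>UNIV. if y = t u then c u else 0) * h y) = (\<Sum>u\<in>UNIV. c u * h (t u))"
    if "\<And>u. t u \<in> ?F" for t :: "'v \<Rightarrow> _" and c :: "'v \<Rightarrow> real"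
  proof -
    have "(\<Sum>y\<in>?F. (\<Sum>u\<in>UNIV. if y = t u then c u else 0) * h y) =
        (\<Sum>y\<in>?F. \<Sum>u\<in>UNIV. if y = t u then c u * h y else 0)"
      by (auto simp: sum_distrib_right intro!: sum.cong)
    also have "\<dots> = (\<Sum>u\<in>UNIV. \<Sum>y\<in>?F. if y = t u then c u * h y else 0)"
      by (rule sum.swap)
    also have "\<dots> = (\<Sum>u\<in>UNIV. c u * h (t u))"
      using that fin by (simp add: sum.delta)
    finally show ?thesis .
  qed
  have "qmch_rate E K lam p nu mu (x, q) y =
      (if snd y = q then mch_rate E K lam p x (fst y) else 0) +
      (\<Sum>u\<in>UNIV. if y = (x, q(u := q u + 1)) then nu u else 0) +
      (\<Sum>u\<in>UNIV. if y = (x, q(u := q u - 1))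
        then (if 1 \<le> q u \<and> x u \<noteq> 0 then mu u else 0) else 0)" for y
    by (cases y) (auto simp: qmch_rate_def intro!: arg_cong2[where f = "(+)"] sum.cong)
  then have "(\<Sum>y\<in>?F. qmch_rate E K lam p nu mu (x, q) y * h y) =
      (\<Sum>y\<in>?F. (if snd y = q then mch_rate E K lam p x (fst y) else 0) * h y) +
      (\<Sum>y\<in>?F. (\<Sum>u\<in>UNIV. if y = (x, q(u := q u + 1)) then nu u else 0) * h y) +
      (\<Sum>y\<in>?F. (\<Sum>u\<in>UNIV. if y = (x, q(u := q u - 1))
        then (if 1 \<le> q u \<and> x u \<noteq> 0 then mu u else 0) else 0) * h y)"
    by (simp only: distrib_right sum.distrib)
  also have "\<dots> = (\<Sum>u\<in>UNIV. lam u * measure_pmf.expectation (mch_update E K p u x) (\<lambda>x'. h (x', q))) +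
      (\<Sum>u\<in>UNIV. nu u * h (x, q(u := q u + 1))) +
      (\<Sum>u\<in>UNIV. (if 1 \<le> q u \<and> x u \<noteq> 0 then mu u else 0) * h (x, q(u := q u - 1)))"
    unfolding 1
    by (subst single, force simp: qmch_targets_def)+ (rule refl)
  also have "(\<Sum>u\<in>UNIV. (if 1 \<le> q u \<and> x u \<noteq> 0 then mu u else 0) * h (x, q(u := q u - 1))) =
      (\<Sum>u\<in>UNIV. if 1 \<le> q u \<and> x u \<noteq> 0 then mu u * h (x, q(u := q u - 1)) else 0)"
    by (intro sum.cong) auto
  finally show ?thesis .
qed

text \<open>The term \<open>q v * g x\<close> replaces the fluctuating service by its mean: hardcore
  moves contribute at most \<open>(f - s') * q v\<close>, whose \<open>f\<close> cancels against the
  service term \<open>- f * q v\<close> of the square. What remains is the linear drift with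
  \<open>nu v - s'\<close> and a bounded part.\<close>

lemma qmch_drift:
  fixes E :: "'v::finite set set" and q :: "'v \<Rightarrow> nat"
  defines "V \<equiv> \<lambda>g v (x, q). real (q v) ^ 2 / 2 + real (q v) * g x"
  assumes E: "simple_graph E" and K: "1 \<le> K" and x: "x \<in> mch_states E K"
    and lam: "(\<Sum>v\<in>UNIV. lam v) = real CARD('v)" and nu: "0 \<le> nu v" "nu v \<le> 1"
    and g: "0 \<le> g x" "g x \<le> B"
    and poisson: "real CARD('v) * (mch_step E K lam p g x - g x) \<le> of_bool (x v \<noteq> 0) - s'"
  shows "(\<Sum>y\<in>qmch_targets E K (x, q). qmch_rate E K lam p nu (\<lambda>_. 1) (x, q) y * (V g v y - V g v (x, q)))
    \<le> 1 + B - (s' - nu v) * real (q v)"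
proof -
  define k where "k = real (q v)"
  define f :: real where "f = of_bool (x v \<noteq> 0)"
  let ?h = "\<lambda>y. V g v y - V g v (x, q)"
  have "(\<Sum>u\<in>UNIV. lam u * measure_pmf.expectation (mch_update E K p u x) (\<lambda>x'. ?h (x', q))) =
      (\<Sum>u\<in>UNIV. lam u * (k * (measure_pmf.expectation (mch_update E K p u x) g - g x)))"
    by (simp add: V_def k_def integrable_mch_update[OF K] flip: right_diff_distrib)
  also have "\<dots> = k * (real CARD('v) * (mch_step E K lam p g x - g x))"
    by (simp add: mch_step_def right_diff_distrib sum_subtractf mult.left_commute lam
        flip: sum_distrib_left sum_distrib_right)
  also have "\<dots> \<le> k * (f - s')"
    using poisson by (intro mult_left_mono) (auto simp: f_def k_def)
  finally have 1: "(\<Sum>u\<in>UNIV. lam u *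
      measure_pmf.expectation (mch_update E K p u x) (\<lambda>x'. ?h (x', q))) \<le> k * (f - s')" .
  have "(\<Sum>u\<in>UNIV. nu u * ?h (x, q(u := q u + 1))) =
      (\<Sum>u\<in>UNIV. if u = v then nu v * (k + 1 / 2 + g x) else 0)"
    by (intro sum.cong) (auto simp: V_def k_def power2_eq_square field_simps)
  then have 2: "(\<Sum>u\<in>UNIV. nu u * ?h (x, q(u := q u + 1))) = nu v * (k + 1 / 2 + g x)"
    by simp
  have "(\<Sum>u\<in>UNIV. if 1 \<le> q u \<and> x u \<noteq> 0 then 1 * ?h (x, q(u := q u - 1)) else 0) =
      (\<Sum>u\<in>UNIV. if u = v then (if 1 \<le> q v \<and> x v \<noteq> 0 then 1 / 2 - k - g x else 0) else 0)"
    by (intro sum.cong) (auto simp: V_def k_def power2_eq_square of_nat_diff field_simps)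
  then have "(\<Sum>u\<in>UNIV. if 1 \<le> q u \<and> x u \<noteq> 0 then 1 * ?h (x, q(u := q u - 1)) else 0) =
      (if 1 \<le> q v \<and> x v \<noteq> 0 then 1 / 2 - k - g x else 0)"
    by simp
  \<comment> \<open>With an inactive vertex or an empty queue \<open>f * k\<close> is 0; otherwise
    \<open>- g x\<close> is dropped, being nonpositive.\<close>
  also have "\<dots> \<le> 1 / 2 - f * k"
    using g by (auto simp: f_def k_def)
  finally have 3: "(\<Sum>u\<in>UNIV. if 1 \<le> q u \<and> x u \<noteq> 0 then 1 * ?h (x, q(u := q u - 1)) else 0)
      \<le> 1 / 2 - f * k" .
  \<comment> \<open>The bounded part of the arrivals; together with \<open>1 / 2\<close> from the
    services it gives \<open>1 + B\<close>.\<close>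
  have "nu v * (1 / 2 + g x) \<le> 1 * (1 / 2 + B)"
    using nu g by (intro mult_mono) auto
  then have
    "a \<le> k * (f - s') \<Longrightarrow> b = nu v * (k + 1 / 2 + g x) \<Longrightarrow> c \<le> 1 / 2 - f * k \<Longrightarrow>
      a + b + c \<le> 1 + B - (s' - nu v) * k" for a b c
    by (simp add: algebra_simps)
  from this[OF 1 2 3] show ?thesis
    unfolding sum_qmch_rate[OF E K x] k_def .
qed

section \<open>The bound on the mean queue length\<close>

theorem corollary2:
  fixes E :: "'v::finite set set" and K :: nat
    and lam p nu s :: "'v \<Rightarrow> real"
    and \<pi> :: "('v \<Rightarrow> nat) pmf"
    and M :: "'a measure"
    and X Q :: "real \<Rightarrow> 'a \<Rightarrow> ('v \<Rightarrow> nat)"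
  assumes "simple_graph E"
    and "1 \<le> min_degree E"
    and "1 \<le> K"
    and "\<forall>v. 0 \<le> p v \<and> p v \<le> 1"
    and "\<forall>v. 0 < nu v"
    and "\<forall>v. lam v = real (vertex_degree E v) / avg_degree E"
    and "\<forall>v. p v \<le> 2 / 3 * real K / real (vertex_degree E v)"
    and "mch_equilibrium E K lam p \<pi>"
    and "\<forall>v. s v = service_rate E K \<pi> v"
    and "\<forall>v. nu v < s v"
    and "qmch M E K lam p nu (\<lambda>_. 1) X Q"
    and "stationary_process M (\<lambda>t \<omega>. (X t \<omega>, Q t \<omega>))"
  shows "\<forall>v. integrable M (\<lambda>\<omega>. real (Q 0 \<omega> v)) \<and>
    (\<integral>\<omega>. real (Q 0 \<omega> v) \<partial>M) \<le>
      18 * avg_degree E * real CARD('v) * ln (2 * exp 1 * real CARD('v)) /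
      (real (min_degree E) * (s v - nu v)\<^sup>2)"
proof (rule allI)
  fix v
  let ?S = "qmch_states E K" and ?r = "qmch_rate E K lam p nu (\<lambda>_. 1)"
  define n where "n = real CARD('v)"
  define B where "B = 6 * avg_degree E * n / real (min_degree E)"
  define t where "t = s v - nu v"
  have a: "1 \<le> real (min_degree E)" "real (min_degree E) \<le> avg_degree E"
    using assms(2) by (simp_all add: min_degree_le_avg_degree)
  have n: "1 \<le> n" by (simp add: n_def Suc_le_eq)
  have lam_nonneg: "\<forall>v. 0 \<le> lam v" using assms(6) a by simp
  have lam_sum: "(\<Sum>v\<in>UNIV. lam v) = real CARD('v)"
    using assms(2,6) by (rule sum_degree_over_avg_degree)
  have supp: "set_pmf \<pi> \<subseteq> mch_states E K"
    using assms(8) by (simp add: mch_equilibrium_def invariant_distribution_def)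
  have "s v = measure_pmf.expectation \<pi> (\<lambda>x. of_bool (x v \<noteq> 0))"
    using assms(9) by (simp add: service_rate_eq[OF supp])
  \<comment> \<open>This yields both \<open>nu v \<le> 1\<close>, needed for the drift, and
    \<open>t \<le> 1\<close>, needed for the final comparison.\<close>
  also have "\<dots> \<le> 1"
    by (rule measure_pmf.integral_le_const)
      (auto intro!: measure_pmf.integrable_const_bound[where B = 1])
  finally have s: "s v \<le> 1" .
  have nu: "0 < nu v" "nu v < s v" using assms(5,10) by simp_all
  with s have t: "0 < t" "t \<le> 1" by (simp_all add: t_def)
  \<comment> \<open>Half of the spare capacity \<open>t\<close> is given up to the error in the
    Poisson equation; the other half remains as negative drift.\<close>
  obtain g where g: "\<And>x. 0 \<le> g x" "\<And>x. g x \<le> B"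
      "\<And>x. real CARD('v) * (mch_step E K lam p g x - g x) \<le>
        of_bool (x v \<noteq> 0) - service_rate E K \<pi> v + t / 2"
    using mch_poisson_approx[OF assms(1,2,3,4,7,6,8), of "t / 2" v] t
    unfolding B_def n_def by auto
  define V where "V = (\<lambda>(x :: 'v \<Rightarrow> nat, q :: 'v \<Rightarrow> nat). real (q v) ^ 2 / 2 + real (q v) * g x)"
  define w where "w z = real (snd z v)" for z :: "('v \<Rightarrow> nat) \<times> ('v \<Rightarrow> nat)"
  obtain \<mu> P where meas: "(\<lambda>\<omega>. (X 0 \<omega>, Q 0 \<omega>)) \<in> measurable M (count_space UNIV)"
    and \<mu>: "measure_pmf \<mu> = distr M (count_space UNIV) (\<lambda>\<omega>. (X 0 \<omega>, Q 0 \<omega>))"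
      "set_pmf \<mu> \<subseteq> ?S" "transition_semigroup ?S ?r P" "\<And>t. 0 \<le> t \<Longrightarrow> bind_pmf \<mu> (P t) = \<mu>"
    by (rule stationary_markov_chain_law[OF assms(11)[unfolded qmch_def] assms(12)]) (rule that)
  have V: "0 \<le> V z" for z using g(1) by (simp add: V_def case_prod_unfold)
  have wV: "w z \<le> V z + 1" for z
  proof -
    have "0 \<le> (w z - 1)\<^sup>2" by simp
    then have "w z \<le> (w z)\<^sup>2 / 2 + 1 / 2" by (simp add: power2_eq_square algebra_simps)
    moreover have "0 \<le> w z * g (fst z)" using g(1) by (simp add: w_def)
    ultimately show ?thesis by (simp add: V_def w_def case_prod_unfold)
  qed
  have R: "(\<Sum>y\<in>qmch_targets E K z. ?r z y) \<le> n + (\<Sum>u\<in>UNIV. nu u) + n" if zS: "z \<in> ?S" for z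
  proof -
    obtain x q where z: "z = (x, q)" "x \<in> mch_states E K"
      using zS by (auto simp: qmch_states_def)
    have "(\<Sum>u\<in>UNIV. if 1 \<le> q u \<and> x u \<noteq> 0 then 1 * 1 else 0 :: real) \<le> (\<Sum>u\<in>(UNIV :: 'v set). 1)"
      by (intro sum_mono) simp
    then show ?thesis
      using sum_qmch_rate[OF assms(1,3) z(2), where q = q and lam = lam and p = p and nu = nu
          and mu = "\<lambda>_. 1" and h = "\<lambda>_. 1"]
      by (simp add: z(1) lam_sum n_def cong: if_cong)
  qed
  have drift: "(\<Sum>y\<in>qmch_targets E K z. ?r z y * (V y - V z)) \<le> (1 + B) - t / 2 * w z"
    if zS: "z \<in> ?S" for z
  proof -
    obtain x q where z: "z = (x, q)" "x \<in> mch_states E K"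
      using zS by (auto simp: qmch_states_def)
    have "s v = nu v + t" by (simp add: t_def)
    with g(3)[of x] assms(9)
    have "real CARD('v) * (mch_step E K lam p g x - g x) \<le> of_bool (x v \<noteq> 0) - (nu v + t / 2)"
      by simp
    then show ?thesis
      using qmch_drift[OF assms(1,3) z(2) lam_sum, where nu = nu and v = v and g = g and B = B
          and s' = "nu v + t / 2" and p = p and q = q] nu s g(1,2)[of x]
      by (simp add: z(1) V_def w_def)
  qed
  have B: "0 \<le> B" using a n by (simp add: B_def)
  have r_nonneg: "0 \<le> ?r z y" for z y
    using assms(5) by (intro qmch_rate_nonneg lam_nonneg) (auto intro: less_imp_le)
  note dr = stationary_drift[OF \<mu>(3,2,4) qmch_targets qmch_rate_outside r_nonneg R V _ wV drift]
  have int: "integrable (measure_pmf \<mu>) w"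
    by (rule dr(1)) (use B t in \<open>auto simp: w_def\<close>)
  have E: "measure_pmf.expectation \<mu> w \<le> (1 + B) / (t / 2)"
    by (rule dr(2)) (use B t in \<open>auto simp: w_def\<close>)
  have int_M: "integrable M (\<lambda>\<omega>. real (Q 0 \<omega> v))"
    using int integrable_distr_eq[OF meas, of w] by (simp add: \<mu>(1) w_def)
  have E_M: "(\<integral>\<omega>. real (Q 0 \<omega> v) \<partial>M) = measure_pmf.expectation \<mu> w"
    using integral_distr[OF meas, of w] by (simp add: \<mu>(1) w_def)
  define A where "A = avg_degree E * n / real (min_degree E)"
  define l where "l = ln (2 * exp 1 * n)"
  have "1 * 1 \<le> (avg_degree E / real (min_degree E)) * n"
    using a n by (intro mult_mono) auto
  then have A: "1 \<le> A" by (simp add: A_def)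
  have "exp 1 * 1 \<le> exp 1 * (2 * n)" using n by (intro mult_left_mono) auto
  then have "ln (exp 1) \<le> l" unfolding l_def using n by (subst ln_le_cancel_iff) (auto simp: mult_ac)
  then have l: "1 \<le> l" by simp
  \<comment> \<open>The bound is of order \<open>1 / t\<close>; one factor \<open>t\<close> is split
    off and then estimated by 1 to reach the denominator \<open>t\<^sup>2\<close>.\<close>
  have "(1 + B) / (t / 2) = (2 + 12 * A) * t / t\<^sup>2"
    using t by (simp add: A_def B_def power2_eq_square field_simps)
  also have "\<dots> \<le> (18 * A * l) / t\<^sup>2"
  proof (rule divide_right_mono)
    \<comment> \<open>From \<open>A \<ge> 1\<close> follows \<open>2 + 12 * A \<le> 14 * A\<close>,
      which leaves room up to 18; the logarithm enters only as a factor of at least 1.\<close>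
    have "(2 + 12 * A) * t \<le> (18 * A) * 1" using A t by (intro mult_mono) auto
    also have "\<dots> \<le> (18 * A) * l" using A l by (intro mult_left_mono) auto
    finally show "(2 + 12 * A) * t \<le> 18 * A * l" .
  qed simp
  also have "\<dots> = 18 * avg_degree E * n * l / (real (min_degree E) * t\<^sup>2)"
    by (simp add: A_def)
  finally show "integrable M (\<lambda>\<omega>. real (Q 0 \<omega> v)) \<and>
    (\<integral>\<omega>. real (Q 0 \<omega> v) \<partial>M) \<le>
      18 * avg_degree E * real CARD('v) * ln (2 * exp 1 * real CARD('v)) /
      (real (min_degree E) * (s v - nu v)\<^sup>2)"
    using E E_M int_M by (simp add: n_def l_def t_def)
qed

end
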